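(* Let $n\ge 4$ and let $T$ be a $d$-equidistant ultrametric $n$-tree with root $r$, all of whose edges have rational weight. For each edge $e$ of $T$, let $h(e)$ be the (well-defined) sum of the weights of all the edges in the path from the top node of $e$ to any leaf below $e$, and let $a_1(e),\dots,a_{n-2}(e)$ be generic complex numbers. For $i\in\{1,\dots,n\}$ and $j\in\{1,\dots,n-2\}$, let $x_i^{(j)}\in\mathbb{K}=\mathbb{C}\{\{t\}\}$ be the sum of the monomials $a_j(e)\,t^{-h(e)}$, where $e$ runs over all edges in the path between $r$ and the leaf $i$. Then the valuation of the determinant of the $n\times n$ matrix $$M=\begin{pmatrix} 1&1&\ldots&1\\ x_1^{(1)}&x_2^{(1)}&\ldots&x_n^{(1)}\\ (x_1^{(1)})^2&(x_2^{(1)})^2&\ldots&(x_n^{(1)})^2\\ x_1^{(2)}&x_2^{(2)}&\ldots&x_n^{(2)} \\ \vdots&\vdots&&\vdots \\ x_1^{(n-2)}&x_2^{(n-2)}&\ldots&x_n^{(n-2)}\end{pmatrix}$$ is equal to $-D$, where $D$ is the total weight of $T$.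
   Context: $\mathbb{K}=\mathbb{C}\{\{t\}\}$ is the field of Puiseux series, i.e. of formal expressions $\omega=\sum_{k=p}^{\infty}c_k t^{k/q}$ with $p\in\mathbb{Z}$, $q\in\mathbb{Z}^+$, $c_k\in\mathbb{C}$, $c_p\neq 0$, together with $0$. Its valuation is $\mathrm{val}(\omega)=p/q$, and $\mathrm{val}(0)=\infty$. An ultrametric $n$-tree is a binary rooted tree (the root has degree two and every other internal node has degree three) with exactly $n$ leaves, labeled bijectively by $\{1,\dots,n\}$, such that: (i) each edge $e$ has a nonnegative real number $w(e)$ associated to it, called the weight of $e$; (ii) it is $d$-equidistant for some $d>0$, i.e. the sum of the weights of the edges in the path from the root to every leaf is precisely $d$; (iii) the sum of the weights of all edges in the path connecting any two different leaves is positive. In particular, individual edges may have weight $0$. The top node of an edge is its endpoint closer to the root; a leaf is below $e$ if the path from the root to that leaf contains $e$. The total weight of a tree is the sum of the weights of all its edges. The rows of $M$ are, in order: the all-ones row, the row of the $x_i^{(1)}$, the row of their squares, and then the rows of the $x_i^{(j)}$ for $j=2,\dots,n-2$. "Generic complex numbers" means that the statement holds whenever the vector $(a_j(e))_{j,e}$ ($1\le j\le n-2$, $e$ an edge of $T$) lies in some nonempty Zariski-open subset (depending on $T$) of the complex affine space of all such vectors. *)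

theory Defs
  imports
    "HOL-Computational_Algebra.Formal_Laurent_Series"
    "HOL-Library.Poly_Mapping"
    "HOL-Library.Sublist"
    "HOL-Library.Extended_Real"
    "HOL-Library.FuncSet"
    "Jordan_Normal_Form.Determinant"
begin

section \<open>Puiseux series over the complex numbers\<close>

text \<open>A Puiseux series is given by its coefficient function on exponents.\<close>

definition puiseux_supp :: "nat \<Rightarrow> (rat \<Rightarrow> complex) \<Rightarrow> bool" where
  "puiseux_supp q f \<longleftrightarrow> q > 0 \<and> (\<exists>p::int. \<forall>r. f r \<noteq> 0 \<longrightarrow> (\<exists>k\<ge>p. r = of_int k / of_nat q))"

typedef puiseux = "{f :: rat \<Rightarrow> complex. \<exists>q. puiseux_supp q f}"
  morphisms pux_coeff Abs_puiseux
  by (rule exI[of _ "\<lambda>_. 0"]) (auto simp: puiseux_supp_def)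

setup_lifting type_definition_puiseux

lemma puiseux_eqI: "(\<And>r. pux_coeff f r = pux_coeff g r) \<Longrightarrow> f = g"
  by (simp add: pux_coeff_inject[symmetric] fun_eq_iff)

text \<open>The substitution of \<open>t\<^sup>1\<^sup>/\<^sup>q\<close> into a Laurent series; the ring axioms are transported along it.\<close>

definition fls_root :: "nat \<Rightarrow> complex fls \<Rightarrow> rat \<Rightarrow> complex" where
  "fls_root q F r = (if r * of_nat q \<in> \<int> then fls_nth F \<lfloor>r * of_nat q\<rfloor> else 0)"

definition raw_times :: "(rat \<Rightarrow> complex) \<Rightarrow> (rat \<Rightarrow> complex) \<Rightarrow> rat \<Rightarrow> complex" where
  "raw_times f g r = (\<Sum>s | f s \<noteq> 0 \<and> g (r - s) \<noteq> 0. f s * g (r - s))"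

lemma fls_root_supp: 
  assumes "q > 0"
  shows "puiseux_supp q (fls_root q F)"
proof -
  have "\<exists>k\<ge>fls_subdegree F. r = of_int k / of_nat q" if r: "fls_root q F r \<noteq> 0" for r
  proof -
    from r have i: "r * of_nat q \<in> \<int>" and nz: "fls_nth F \<lfloor>r * of_nat q\<rfloor> \<noteq> 0"
      by (auto simp: fls_root_def split: if_splits)
    have "fls_subdegree F \<le> \<lfloor>r * of_nat q\<rfloor>"
      using nz by (rule fls_subdegree_leI)
    moreover have "r = of_int \<lfloor>r * of_nat q\<rfloor> / of_nat q"
      using i assms by (auto simp: Ints_def field_simps)
    ultimately show ?thesis by blast
  qed
  then show ?thesis using assms by (auto simp: puiseux_supp_def)
qed

lemma puiseux_supp_imp_fls_root:
  assumes "puiseux_supp q f"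
  obtains F where "f = fls_root q F"
proof -
  from assms obtain p where q: "q > 0" and p: "\<And>r. f r \<noteq> 0 \<Longrightarrow> \<exists>k\<ge>p. r = of_int k / of_nat q"
    by (auto simp: puiseux_supp_def)
  define F where "F = Abs_fls (\<lambda>k. f (of_int k / of_nat q))"
  have F: "fls_nth F k = f (of_int k / of_nat q)" for k
    unfolding F_def
  proof (subst nth_Abs_fls_ex_lower_bound)
    show "\<exists>N. \<forall>n<N. f (of_int n / of_nat q) = 0"
    proof (intro exI[of _ p] allI impI, rule ccontr)
      fix n assume n: "n < p" "f (of_int n / of_nat q) \<noteq> 0"
      from p[OF n(2)] obtain k where k: "k \<ge> p" "(of_int n / of_nat q :: rat) = of_int k / of_nat q" 
        by blast
      then have "n = k" using q by simp
      then show False using n k by simp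
    qed
  qed simp
  have "f r = fls_root q F r" for r
  proof (cases "r * of_nat q \<in> \<int>")
    case True
    then have "of_int \<lfloor>r * of_nat q\<rfloor> / of_nat q = r"
      using q by (auto simp: Ints_def field_simps)
    then show ?thesis using True by (simp add: fls_root_def F)
  next
    case False
    have "f r = 0"
    proof (rule ccontr)
      assume "f r \<noteq> 0"
      from p[OF this] obtain k where "r = of_int k / of_nat q" by blast
      then have "r * of_nat q = of_int k" using q by simp
      with False show False by simp
    qed
    then show ?thesis using False by (simp add: fls_root_def)
  qed
  then show thesis using that by blast
qed

lemma puiseux_supp_mult:
  assumes "puiseux_supp q f" "m > 0"
  shows "puiseux_supp (q * m) f"
proof -
  from assms obtain p where q: "q > 0" and p: "\<And>r. f r \<noteq> 0 \<Longrightarrow> \<exists>k\<ge>p. r = of_int k / of_nat q"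
    by (auto simp: puiseux_supp_def)
  have "\<exists>k\<ge>p * int m. r = of_int k / of_nat (q * m)" if "f r \<noteq> 0" for r
  proof -
    from p[OF that] obtain k where k: "k \<ge> p" "r = of_int k / of_nat q" by blast
    have "k * int m \<ge> p * int m" using k by (simp add: mult_right_mono)
    moreover have "r = of_int (k * int m) / of_nat (q * m)"
      using k q assms(2) by (simp add: field_simps)
    ultimately show ?thesis by blast
  qed
  then show ?thesis using q assms(2) by (auto simp: puiseux_supp_def)
qed

lemma fls_root_times:
  assumes q: "q > 0"
  shows "raw_times (fls_root q F) (fls_root q G) = fls_root q (F * G)"
proof
  fix r
  let ?A = "{s. fls_root q F s \<noteq> 0 \<and> fls_root q G (r - s) \<noteq> 0}"
  have int: "s * of_nat q \<in> \<int> \<and> (r - s) * of_nat q \<in> \<int>" if "s \<in> ?A" for s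
    using that by (auto simp: fls_root_def split: if_splits)
  show "raw_times (fls_root q F) (fls_root q G) r = fls_root q (F * G) r"
  proof (cases "r * of_nat q \<in> \<int>")
    case False
    have "?A = {}"
    proof (rule ccontr)
      assume "?A \<noteq> {}"
      then obtain s where "s \<in> ?A" by blast
      from int[OF this] have "s * of_nat q + (r - s) * of_nat q \<in> \<int>" by (intro Ints_add) auto
      then show False using False by (simp add: algebra_simps)
    qed
    then show ?thesis using False unfolding raw_times_def by (simp only: fls_root_def) simp
  next
    case True
    then obtain n where n: "r * of_nat q = of_int n" by (auto simp: Ints_def)
    let ?B = "{i. fls_nth F i \<noteq> 0 \<and> fls_nth G (n - i) \<noteq> 0}"
    have rF: "fls_root q F (of_int i / of_nat q) = fls_nth F i" for i
      using q by (simp add: fls_root_def)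
    have sub: "r - of_int i / of_nat q = of_int (n - i) / of_nat q" for i
      using q n by (simp add: field_simps)
    have rG: "fls_root q G (r - of_int i / of_nat q) = fls_nth G (n - i)" for i
      using q by (simp add: fls_root_def sub)
    have "raw_times (fls_root q F) (fls_root q G) r = (\<Sum>i\<in>?B. fls_nth F i * fls_nth G (n - i))"
      unfolding raw_times_def
    proof (rule sum.reindex_bij_witness[where i = "\<lambda>i. of_int i / of_nat q" and j = "\<lambda>s. \<lfloor>s * of_nat q\<rfloor>"])
      fix s assume s: "s \<in> ?A"
      from int[OF s] obtain i where i: "s * of_nat q = of_int i" by (auto simp: Ints_def)
      then have se: "s = of_int i / of_nat q" using q by (simp add: field_simps)
      show "of_int \<lfloor>s * of_nat q\<rfloor> / of_nat q = s" using i se by simp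
      show "\<lfloor>s * of_nat q\<rfloor> \<in> ?B" using s i by (simp add: se rF rG)
      show "fls_nth F \<lfloor>s * of_nat q\<rfloor> * fls_nth G (n - \<lfloor>s * of_nat q\<rfloor>) = 
            fls_root q F s * fls_root q G (r - s)" 
        unfolding i by (simp add: se rF rG)
    next
      fix i assume "i \<in> ?B"
      then show "\<lfloor>of_int i / of_nat q * of_nat q :: rat\<rfloor> = i" "of_int i / of_nat q \<in> ?A"
        using q by (simp_all add: rF rG)
    qed
    also have "\<dots> = (\<Sum>i=fls_subdegree F..n - fls_subdegree G. fls_nth F i * fls_nth G (n - i))"
    proof (rule sum.mono_neutral_left)
      show "?B \<subseteq> {fls_subdegree F..n - fls_subdegree G}"
      proof
        fix i assume "i \<in> ?B"
        then have "fls_subdegree F \<le> i" "fls_subdegree G \<le> n - i"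
          by (auto intro: fls_subdegree_leI)
        then show "i \<in> {fls_subdegree F..n - fls_subdegree G}" by simp
      qed
    qed auto
    also have "\<dots> = fls_root q (F * G) r"
      using True n by (simp add: fls_root_def fls_times_nth(2))
    finally show ?thesis .
  qed
qed

lemma common_denom2:
  assumes "\<exists>q. puiseux_supp q f" "\<exists>q. puiseux_supp q g"
  obtains q F G where "q > 0" "f = fls_root q F" "g = fls_root q G"
proof -
  from assms obtain q1 q2 where q: "puiseux_supp q1 f" "puiseux_supp q2 g" by blast
  then have pos: "q1 > 0" "q2 > 0" by (auto simp: puiseux_supp_def)
  have "puiseux_supp (q1 * q2) f" "puiseux_supp (q1 * q2) g"
    using puiseux_supp_mult[OF q(1) pos(2)] puiseux_supp_mult[OF q(2) pos(1)] 
    by (simp_all add: mult.commute)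
  then show thesis using that pos by (metis puiseux_supp_imp_fls_root nat_0_less_mult_iff)
qed

lemma fls_root_add: "fls_root q (F + G) r = fls_root q F r + fls_root q G r"
  and fls_root_uminus: "fls_root q (- F) r = - fls_root q F r"
  and fls_root_minus: "fls_root q (F - G) r = fls_root q F r - fls_root q G r"
  by (auto simp: fls_root_def)

lemma fls_root_0: "fls_root q 0 = (\<lambda>_. 0)"
  by (auto simp: fls_root_def)

lemma fls_root_1: "q > 0 \<Longrightarrow> fls_root q 1 = (\<lambda>r. if r = 0 then 1 else 0)"
  by (auto simp: fls_root_def fun_eq_iff Ints_def)

instantiation puiseux :: "{zero, one, plus, minus, uminus, times}"
begin

lift_definition zero_puiseux :: puiseux is "\<lambda>_. 0"
  by (auto simp: puiseux_supp_def)

lift_definition one_puiseux :: puiseux is "\<lambda>r. if r = 0 then 1 else 0"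
  by (rule exI[of _ 1]) (auto simp: puiseux_supp_def)

lift_definition plus_puiseux :: "puiseux \<Rightarrow> puiseux \<Rightarrow> puiseux" is "\<lambda>f g r. f r + g r"
  by (erule (1) common_denom2) (auto simp: fls_root_add[symmetric] intro: fls_root_supp)

lift_definition minus_puiseux :: "puiseux \<Rightarrow> puiseux \<Rightarrow> puiseux" is "\<lambda>f g r. f r - g r"
  by (erule (1) common_denom2) (auto simp: fls_root_minus[symmetric] intro: fls_root_supp)

lift_definition uminus_puiseux :: "puiseux \<Rightarrow> puiseux" is "\<lambda>f r. - f r"
  by (auto simp: puiseux_supp_def)

lift_definition times_puiseux :: "puiseux \<Rightarrow> puiseux \<Rightarrow> puiseux" is
  "\<lambda>f g r. \<Sum>s | f s \<noteq> 0 \<and> g (r - s) \<noteq> 0. f s * g (r - s)"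
  by (erule (1) common_denom2, fold raw_times_def) 
     (auto simp: raw_times_def[symmetric] fls_root_times intro: fls_root_supp)

instance ..

end

lemma pux_coeff_times: "pux_coeff (f * g) = raw_times (pux_coeff f) (pux_coeff g)"
  by (simp add: times_puiseux.rep_eq raw_times_def fun_eq_iff)

lift_definition pux_of_fls :: "nat \<Rightarrow> complex fls \<Rightarrow> puiseux" is "\<lambda>q. fls_root (Suc q)"
  by (auto intro: fls_root_supp)

lemma pux_of_fls_hom:
  "pux_of_fls q F + pux_of_fls q G = pux_of_fls q (F + G)"
  "pux_of_fls q F - pux_of_fls q G = pux_of_fls q (F - G)"
  "- pux_of_fls q F = pux_of_fls q (- F)"
  "pux_of_fls q F * pux_of_fls q G = pux_of_fls q (F * G)"
  "0 = pux_of_fls q 0" "1 = pux_of_fls q 1"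
  by (rule puiseux_eqI; simp add: plus_puiseux.rep_eq minus_puiseux.rep_eq uminus_puiseux.rep_eq 
       zero_puiseux.rep_eq one_puiseux.rep_eq pux_coeff_times pux_of_fls.rep_eq fls_root_add 
       fls_root_minus fls_root_uminus fls_root_times fls_root_0 fls_root_1)+

lemma pux_of_fls_ex3: "\<exists>q F G H. f = pux_of_fls q F \<and> g = pux_of_fls q G \<and> h = pux_of_fls q H"
proof -
  obtain q1 q2 q3 where q: "puiseux_supp q1 (pux_coeff f)" "puiseux_supp q2 (pux_coeff g)" 
    "puiseux_supp q3 (pux_coeff h)"
    using pux_coeff by blast
  then have pos: "q1 > 0" "q2 > 0" "q3 > 0" by (auto simp: puiseux_supp_def)
  have s: "puiseux_supp (q1 * q2 * q3) (pux_coeff f)" "puiseux_supp (q1 * q2 * q3) (pux_coeff g)"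
       "puiseux_supp (q1 * q2 * q3) (pux_coeff h)"
    using puiseux_supp_mult[OF q(1), of "q2 * q3"] puiseux_supp_mult[OF q(2), of "q1 * q3"]
          puiseux_supp_mult[OF q(3), of "q1 * q2"] pos
    by (simp_all add: ac_simps)
  obtain n where n: "q1 * q2 * q3 = Suc n" 
    using pos by (metis gr0_conv_Suc nat_0_less_mult_iff)
  from s[unfolded n] obtain F G H where "pux_coeff f = fls_root (Suc n) F" 
    "pux_coeff g = fls_root (Suc n) G" "pux_coeff h = fls_root (Suc n) H" 
    by (metis puiseux_supp_imp_fls_root)
  then show ?thesis
    by (intro exI[of _ n] exI[of _ F] exI[of _ G] exI[of _ H]) 
       (auto intro!: puiseux_eqI simp: pux_of_fls.rep_eq)
qed

lemma pux_of_fls_eq_iff: "pux_of_fls q F = pux_of_fls q G \<longleftrightarrow> F = G"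
proof
  assume eq: "pux_of_fls q F = pux_of_fls q G"
  have "fls_root (Suc q) H (of_int i / of_nat (Suc q)) = fls_nth H i" for i H
    by (simp add: fls_root_def del: of_nat_Suc)
  then show "F = G" using eq 
    by (metis fls_eqI pux_of_fls.rep_eq)
qed auto

instance puiseux :: idom
proof
  fix a b c :: puiseux
  obtain q F G H where *: "a = pux_of_fls q F" "b = pux_of_fls q G" "c = pux_of_fls q H"
    using pux_of_fls_ex3 by blast
  note hom = pux_of_fls_hom(1-4) pux_of_fls_hom(5,6)[of q] pux_of_fls_eq_iff *
  show "a + b + c = a + (b + c)" "a + b = b + a" "0 + a = a" "- a + a = 0" "a - b = a + - b"
    "a * b * c = a * (b * c)" "a * b = b * a" "1 * a = a" "(a + b) * c = a * c + b * c"
    "a * (b + c) = a * b + a * c" "0 * a = 0" "a * 0 = 0" "(0::puiseux) \<noteq> 1"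
    unfolding hom by (simp_all add: algebra_simps)
  show "a * b \<noteq> 0" if "a \<noteq> 0" "b \<noteq> 0"
    using that unfolding hom by simp
qed

instantiation puiseux :: field
begin

definition inverse_puiseux :: "puiseux \<Rightarrow> puiseux" where
  "inverse_puiseux f = (if f = 0 then 0 else (THE g. f * g = 1))"

definition divide_puiseux :: "puiseux \<Rightarrow> puiseux \<Rightarrow> puiseux" where
  "divide_puiseux f g = f * inverse g"

instance
proof
  fix a b :: puiseux
  assume a: "a \<noteq> 0"
  obtain q F where F: "a = pux_of_fls q F"
    using pux_of_fls_ex3 by blast
  then have "F \<noteq> 0" using a unfolding pux_of_fls_hom(5)[of q] by auto
  then have "a * pux_of_fls q (inverse F) = 1"
    unfolding F pux_of_fls_hom(4) pux_of_fls_hom(6)[of q] by (simp add: field_simps)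
  then have "\<exists>!g. a * g = 1"
    using a by (metis mult_cancel_left)
  then have "a * inverse a = 1"
    using a theI'[of "\<lambda>g. a * g = 1"] by (simp add: inverse_puiseux_def)
  then show "inverse a * a = 1" by (simp add: mult.commute)
qed (simp_all add: divide_puiseux_def inverse_puiseux_def)

end

lift_definition pux_monom :: "complex \<Rightarrow> rat \<Rightarrow> puiseux" is "\<lambda>c s r. if r = s then c else 0"
proof -
  fix c :: complex and s :: rat
  obtain a b where ab: "s = of_int a / of_int b" "b > 0"
    by (cases s) (auto simp: Fract_of_int_quotient)
  then have "puiseux_supp (nat b) (\<lambda>r. if r = s then c else 0)"
    by (auto simp: puiseux_supp_def intro!: exI[of _ a])
  then show "\<exists>q. puiseux_supp q (\<lambda>r. if r = s then c else 0)" by blast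
qed

definition pux_val :: "puiseux \<Rightarrow> ereal" where
  "pux_val f = (if f = 0 then \<infinity> else ereal (of_rat (LEAST r. pux_coeff f r \<noteq> 0)))"


section \<open>Zariski-open sets\<close>

text \<open>
  A polynomial in variables indexed by \<open>'i\<close> is a finitely supported map from monomials
  (finitely supported exponent vectors) to coefficients.
\<close>

definition mpoly_eval :: "(('i \<Rightarrow>\<^sub>0 nat) \<Rightarrow>\<^sub>0 complex) \<Rightarrow> ('i \<Rightarrow> complex) \<Rightarrow> complex" where
  "mpoly_eval P x = (\<Sum>m\<in>Poly_Mapping.keys P. Poly_Mapping.lookup P m * (\<Prod>i\<in>Poly_Mapping.keys m. x i ^ Poly_Mapping.lookup m i))"

definition mpoly_vars :: "(('i \<Rightarrow>\<^sub>0 nat) \<Rightarrow>\<^sub>0 complex) \<Rightarrow> 'i set" where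
  "mpoly_vars P = (\<Union>m\<in>Poly_Mapping.keys P. Poly_Mapping.keys m)"

text \<open>The affine space with coordinates indexed by \<open>I\<close> is \<open>I \<rightarrow>\<^sub>E UNIV\<close>.\<close>

definition zariski_open :: "'i set \<Rightarrow> ('i \<Rightarrow> complex) set \<Rightarrow> bool" where
  "zariski_open I U \<longleftrightarrow> (\<exists>\<P>. (\<forall>P\<in>\<P>. mpoly_vars P \<subseteq> I) \<and>
     U = {x \<in> I \<rightarrow>\<^sub>E UNIV. \<exists>P\<in>\<P>. mpoly_eval P x \<noteq> 0})"


section \<open>Ultrametric trees\<close>

text \<open>
  \<open>Node u S v T\<close> is a root with two subtrees \<open>S\<close> and \<open>T\<close>, hanging from edges of weights \<open>u\<close> and \<open>v\<close>.
  The order of the two subtrees carries no information; it only serves to name the nodes.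
\<close>

datatype wtree = Leaf nat | Node real wtree real wtree

text \<open>
  A node is named by the list of turns (\<open>False\<close> for the first subtree) leading to it from the root,
  so \<^const>\<open>prefix\<close> is the ancestor relation. An edge is named by its endpoint further from the root.
\<close>

primrec edges :: "wtree \<Rightarrow> bool list set" where
  "edges (Leaf i) = {}"
| "edges (Node u S v T) = {[False], [True]} \<union> (#) False ` edges S \<union> (#) True ` edges T"

fun weight :: "wtree \<Rightarrow> bool list \<Rightarrow> real" where
  "weight (Node u S v T) [False] = u"
| "weight (Node u S v T) [True] = v"
| "weight (Node u S v T) (False # e) = weight S e"
| "weight (Node u S v T) (True # e) = weight T e"
| "weight _ _ = 0"

primrec leaves :: "wtree \<Rightarrow> (bool list \<times> nat) set" where
  "leaves (Leaf i) = {([], i)}"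
| "leaves (Node u S v T) = map_prod ((#) False) id ` leaves S \<union> map_prod ((#) True) id ` leaves T"

text \<open>The edges on the path from the root to the leaf labelled \<open>i\<close>, i.e. those having that leaf below.\<close>

definition root_path :: "wtree \<Rightarrow> nat \<Rightarrow> bool list set" where
  "root_path T i = {e \<in> edges T. \<exists>p. (p, i) \<in> leaves T \<and> prefix e p}"

definition ultrametric_tree :: "nat \<Rightarrow> real \<Rightarrow> wtree \<Rightarrow> bool" where
  "ultrametric_tree n d T \<longleftrightarrow>
     bij_betw snd (leaves T) {1..n} \<and>
     (\<forall>e\<in>edges T. weight T e \<ge> 0) \<and>
     d > 0 \<and> (\<forall>i\<in>{1..n}. (\<Sum>e\<in>root_path T i. weight T e) = d) \<and>
     \<comment> \<open>the path between two leaves consists of the edges on exactly one of their root paths\<close>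
     (\<forall>i\<in>{1..n}. \<forall>j\<in>{1..n}. i \<noteq> j \<longrightarrow>
        (\<Sum>e\<in>(root_path T i - root_path T j) \<union> (root_path T j - root_path T i). weight T e) > 0)"

definition total_weight :: "wtree \<Rightarrow> real" where
  "total_weight T = (\<Sum>e\<in>edges T. weight T e)"

text \<open>The sum does not depend on the leaf \<open>i\<close> below \<open>e\<close> when the tree is equidistant.\<close>

definition height :: "wtree \<Rightarrow> bool list \<Rightarrow> real" where
  "height T e = (THE s. \<forall>i. e \<in> root_path T i \<longrightarrow>
     s = (\<Sum>f | f \<in> root_path T i \<and> prefix e f. weight T f))"


section \<open>The matrix\<close>

text \<open>\<open>the_inv of_rat\<close> turns the rational real number \<open>height T e\<close> into an exponent.\<close>

definition leaf_series :: "wtree \<Rightarrow> (nat \<times> bool list \<Rightarrow> complex) \<Rightarrow> nat \<Rightarrow> nat \<Rightarrow> puiseux" where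
  "leaf_series T a j i = (\<Sum>e\<in>root_path T i. pux_monom (a (j, e)) (- the_inv of_rat (height T e)))"

definition tree_matrix :: "nat \<Rightarrow> wtree \<Rightarrow> (nat \<times> bool list \<Rightarrow> complex) \<Rightarrow> puiseux mat" where
  "tree_matrix n T a = mat n n (\<lambda>(k, l). let i = l + 1 in
     if k = 0 then 1
     else if k = 1 then leaf_series T a 1 i
     else if k = 2 then (leaf_series T a 1 i)\<^sup>2
     else leaf_series T a (k - 1) i)"

end

theory Submission
  imports Defs
begin

text \<open>
  Order the leaves from left to right. Two consecutive leaves have a lowest common ancestor, the
  fork between them, and each of the \<open>n - 1\<close> internal nodes is the fork of exactly one such pair.
  Subtracting from every column its left neighbour leaves the determinant unchanged. In the column
  of a fork of height \<open>H\<close> the monomials of the edges above the fork cancel, so the linear entries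
  have valuation at least \<open>- H\<close>. The quadratic entry is a difference of squares, that is, the linear
  entry times a sum, and has valuation at least \<open>- H - d\<close>. The first row becomes \<open>(1, 0, \<dots>, 0)\<close>. Hence
  each term of the Leibniz formula has valuation at least \<open>- (d + \<Sum> H)\<close>, where the sum runs over the
  internal nodes, and \<open>d + \<Sum> H\<close> is the total weight \<open>D\<close> (\<open>total_weight_node_heights\<close>).

  The coefficient of the determinant at exponent \<open>- D\<close> is the determinant of the matrix of leading
  coefficients (\<open>det_series_matrix_leading\<close>), which is a polynomial in the complex numbers \<open>a\<^sub>j(e)\<close>.
  Where it does not vanish, the valuation is \<open>- D\<close>. So it remains to find one choice of the numbers
  for which it does not vanish.

  For fixed \<open>j\<close> the linear leading coefficients at the forks are linear forms in the \<open>a\<^sub>j(e)\<close>. They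
  are triangular with respect to the edges that leave the forks to the right, and can therefore
  take arbitrary values (\<open>fork_values_arbitrary\<close>). The rows with \<open>j \<ge> 2\<close> are used to isolate all forks
  except the root and one further fork. The block of these two forks in the linear and the
  quadratic row with \<open>j = 1\<close> is invertible as soon as the leading coefficients of the two sums in the
  differences of squares are distinct. This is achieved by changing the coefficient of the right
  edge at the root by \<open>s\<close>, which changes the sum at the root by \<open>s\<close> and every other sum by \<open>0\<close> or \<open>2 s\<close>
  (\<open>fork_top_sum_independent\<close>).

  Only the bookkeeping of edges on paths enters this argument. It is carried out in the locale
  \<open>path_system\<close>, of which the tree is then shown to be an instance (\<open>tree_path_system\<close>).
\<close>

section \<open>Polynomial functions\<close>

text \<open>
  Polynomial functions are handled through their closure properties, so that no polynomial with
  the determinant as its value has to be written down.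
\<close>

definition polyfun :: "'i set \<Rightarrow> (('i \<Rightarrow> complex) \<Rightarrow> complex) \<Rightarrow> bool" where
  "polyfun I f \<longleftrightarrow> (\<exists>P. mpoly_vars P \<subseteq> I \<and> (\<forall>x. mpoly_eval P x = f x))"

lemma mpoly_eval_superset:
  assumes "finite A" "Poly_Mapping.keys P \<subseteq> A"
  shows "mpoly_eval P x =
    (\<Sum>m\<in>A. Poly_Mapping.lookup P m * (\<Prod>i\<in>Poly_Mapping.keys m. x i ^ Poly_Mapping.lookup m i))"
  unfolding mpoly_eval_def
  by (rule sum.mono_neutral_left) (use assms in \<open>auto simp: in_keys_iff\<close>)

text \<open>
  The products run over different sets of variables; both sides are compared on the union, where
  the additional factors are zeroth powers.
\<close>

lemma monomial_eval_add:
  "(\<Prod>i\<in>Poly_Mapping.keys (m + k). x i ^ Poly_Mapping.lookup (m + k) i) =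
   (\<Prod>i\<in>Poly_Mapping.keys m. x i ^ Poly_Mapping.lookup m i) *
   (\<Prod>i\<in>Poly_Mapping.keys k. (x i :: complex) ^ Poly_Mapping.lookup k i)"
proof -
  let ?A = "Poly_Mapping.keys m \<union> Poly_Mapping.keys k"
  have *: "(\<Prod>i\<in>Poly_Mapping.keys l. x i ^ Poly_Mapping.lookup l i) =
      (\<Prod>i\<in>?A. x i ^ Poly_Mapping.lookup l i)" if "Poly_Mapping.keys l \<subseteq> ?A" for l
    by (rule prod.mono_neutral_left) (use that in \<open>auto simp: in_keys_iff\<close>)
  have "(\<Prod>i\<in>Poly_Mapping.keys (m + k). x i ^ Poly_Mapping.lookup (m + k) i) =
      (\<Prod>i\<in>?A. x i ^ Poly_Mapping.lookup m i) * (\<Prod>i\<in>?A. x i ^ Poly_Mapping.lookup k i)"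
    by (rule trans[OF *[OF keys_add]]) (simp only: lookup_add power_add prod.distrib)
  then show ?thesis
    using *[of m] *[of k] by simp
qed

lemma mpoly_eval_0: "mpoly_eval 0 x = 0"
  by (simp add: mpoly_eval_def)

lemma mpoly_eval_add: "mpoly_eval (P + Q) x = mpoly_eval P x + mpoly_eval Q x"
proof -
  have "mpoly_eval R x = (\<Sum>m\<in>Poly_Mapping.keys P \<union> Poly_Mapping.keys Q. Poly_Mapping.lookup R m *
      (\<Prod>i\<in>Poly_Mapping.keys m. x i ^ Poly_Mapping.lookup m i))"
    if "Poly_Mapping.keys R \<subseteq> Poly_Mapping.keys P \<union> Poly_Mapping.keys Q" for R
    by (rule mpoly_eval_superset) (use that in auto)
  from this[of P] this[of Q] this[of "P + Q"] show ?thesis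
    using keys_add[of P Q] by (simp add: lookup_add sum.distrib ring_distribs)
qed

lemma mpoly_eval_sum: "mpoly_eval (sum F A) x = (\<Sum>i\<in>A. mpoly_eval (F i) x)"
  by (induction A rule: infinite_finite_induct) (simp_all add: mpoly_eval_0 mpoly_eval_add)

lemma mpoly_eval_single:
  "mpoly_eval (Poly_Mapping.single m c) x =
    c * (\<Prod>i\<in>Poly_Mapping.keys m. x i ^ Poly_Mapping.lookup m i)"
  by (subst mpoly_eval_superset[of "{m}"]) auto

lemma sum_single_lookup:
  "(\<Sum>m\<in>Poly_Mapping.keys P. Poly_Mapping.single m (Poly_Mapping.lookup P m)) = P"
proof (rule poly_mapping_eqI)
  fix k
  show "Poly_Mapping.lookup (\<Sum>m\<in>Poly_Mapping.keys P. Poly_Mapping.single m (Poly_Mapping.lookup P m)) k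
      = Poly_Mapping.lookup P k"
    by (auto simp: lookup_sum lookup_single when_def in_keys_iff)
qed

lemma mpoly_eval_mult: "mpoly_eval (P * Q) x = mpoly_eval P x * mpoly_eval Q x"
proof -
  let ?s = "Poly_Mapping.single" and ?l = "Poly_Mapping.lookup"
  have "mpoly_eval (P * Q) x = mpoly_eval ((\<Sum>m\<in>Poly_Mapping.keys P. ?s m (?l P m)) *
      (\<Sum>k\<in>Poly_Mapping.keys Q. ?s k (?l Q k))) x"
    by (simp only: sum_single_lookup)
  also have "\<dots> = (\<Sum>m\<in>Poly_Mapping.keys P. \<Sum>k\<in>Poly_Mapping.keys Q. 
      mpoly_eval (?s (m + k) (?l P m * ?l Q k)) x)"
    by (simp add: sum_product mpoly_eval_sum mult_single)
  also have "\<dots> = mpoly_eval P x * mpoly_eval Q x"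
    by (simp add: mpoly_eval_single monomial_eval_add mpoly_eval_def[of P] mpoly_eval_def[of Q] 
        sum_product ac_simps)
  finally show ?thesis .
qed

lemma polyfun_const: "polyfun I (\<lambda>_. c)"
  unfolding polyfun_def
  by (rule exI[of _ "Poly_Mapping.single 0 c"]) (auto simp: mpoly_eval_single mpoly_vars_def)

lemma polyfun_var: "i \<in> I \<Longrightarrow> polyfun I (\<lambda>x. x i)"
  unfolding polyfun_def
  by (rule exI[of _ "Poly_Mapping.single (Poly_Mapping.single i 1) 1"])
     (auto simp: mpoly_eval_single mpoly_vars_def)

lemma polyfun_add:
  assumes "polyfun I f" "polyfun I g"
  shows "polyfun I (\<lambda>x. f x + g x)"
proof -
  from assms obtain P Q where PQ: "mpoly_vars P \<subseteq> I" "\<And>x. mpoly_eval P x = f x"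
    "mpoly_vars Q \<subseteq> I" "\<And>x. mpoly_eval Q x = g x"
    unfolding polyfun_def by blast
  have "mpoly_vars (P + Q) \<subseteq> mpoly_vars P \<union> mpoly_vars Q"
    using keys_add[of P Q] unfolding mpoly_vars_def by blast
  with PQ show ?thesis
    unfolding polyfun_def by (intro exI[of _ "P + Q"]) (auto simp: mpoly_eval_add)
qed

lemma polyfun_mult:
  assumes "polyfun I f" "polyfun I g"
  shows "polyfun I (\<lambda>x. f x * g x)"
proof -
  from assms obtain P Q where PQ: "mpoly_vars P \<subseteq> I" "\<And>x. mpoly_eval P x = f x"
    "mpoly_vars Q \<subseteq> I" "\<And>x. mpoly_eval Q x = g x"
    unfolding polyfun_def by blast
  have "mpoly_vars (P * Q) \<subseteq> mpoly_vars P \<union> mpoly_vars Q"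
  proof
    fix i assume "i \<in> mpoly_vars (P * Q)"
    then obtain m k where "m \<in> Poly_Mapping.keys P" "k \<in> Poly_Mapping.keys Q" 
      "i \<in> Poly_Mapping.keys (m + k)"
      using keys_mult[of P Q] unfolding mpoly_vars_def by blast
    then show "i \<in> mpoly_vars P \<union> mpoly_vars Q"
      using keys_add[of m k] unfolding mpoly_vars_def by blast
  qed
  with PQ show ?thesis
    unfolding polyfun_def by (intro exI[of _ "P * Q"]) (auto simp: mpoly_eval_mult)
qed

lemma polyfun_diff: "polyfun I f \<Longrightarrow> polyfun I g \<Longrightarrow> polyfun I (\<lambda>x. f x - g x)"
  using polyfun_add[of I f "\<lambda>x. - 1 * g x"] polyfun_mult[OF polyfun_const[of I "- 1"], of g] by simp

lemma polyfun_power: "polyfun I f \<Longrightarrow> polyfun I (\<lambda>x. f x ^ k)"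
  by (induction k) (simp_all only: power_0 power_Suc polyfun_const polyfun_mult)

lemma polyfun_sum: "(\<And>i. i \<in> A \<Longrightarrow> polyfun I (f i)) \<Longrightarrow> polyfun I (\<lambda>x. \<Sum>i\<in>A. f i x)"
proof (induction A rule: infinite_finite_induct)
  case (insert i A)
  have "polyfun I (\<lambda>x. f i x + (\<Sum>i\<in>A. f i x))"
    by (rule polyfun_add) (use insert in auto)
  then show ?case
    using insert by simp
qed (simp_all add: polyfun_const)

lemma polyfun_prod: "(\<And>i. i \<in> A \<Longrightarrow> polyfun I (f i)) \<Longrightarrow> polyfun I (\<lambda>x. \<Prod>i\<in>A. f i x)"
proof (induction A rule: infinite_finite_induct)
  case (insert i A)
  have "polyfun I (\<lambda>x. f i x * (\<Prod>i\<in>A. f i x))"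
    by (rule polyfun_mult) (use insert in auto)
  then show ?case
    using insert by simp
qed (simp_all add: polyfun_const)

text \<open>
  By the Leibniz formula the determinant is a polynomial in the entries.
\<close>

lemma polyfun_det:
  assumes "\<And>x. N x \<in> carrier_mat n n"
    and "\<And>k l. k < n \<Longrightarrow> l < n \<Longrightarrow> polyfun I (\<lambda>x. N x $$ (k, l))"
  shows "polyfun I (\<lambda>x. det (N x))"
proof -
  have "det (N x) = (\<Sum>p | p permutes {0..<n}. signof p * (\<Prod>k = 0..<n. N x $$ (k, p k)))" for x
    by (rule det_def') (rule assms)
  moreover have "p k < n" if "p permutes {0..<n}" "k < n" for p k
    using that permutes_in_image[of p "{0..<n}" k] by auto
  ultimately show ?thesis
    by (auto intro!: polyfun_sum polyfun_mult polyfun_prod polyfun_const assms)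
qed

lemma polyfun_nonzero_zariski_open:
  assumes "polyfun I f"
  shows "zariski_open I {x \<in> I \<rightarrow>\<^sub>E UNIV. f x \<noteq> 0}"
proof -
  from assms obtain P where "mpoly_vars P \<subseteq> I" "\<And>x. mpoly_eval P x = f x"
    unfolding polyfun_def by blast
  then show ?thesis
    unfolding zariski_open_def by (intro exI[of _ "{P}"]) auto
qed

section \<open>Leading coefficients of Puiseux series\<close>

definition pux_order_ge :: "rat \<Rightarrow> puiseux \<Rightarrow> bool" where
  "pux_order_ge r f \<longleftrightarrow> (\<forall>s<r. pux_coeff f s = 0)"

lemma pux_coeff_sum: "pux_coeff (sum f A) r = (\<Sum>i\<in>A. pux_coeff (f i) r)"
  by (induction A rule: infinite_finite_induct) (simp_all add: zero_puiseux.rep_eq plus_puiseux.rep_eq)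

lemma pux_order_ge_0: "pux_order_ge r 0"
  by (simp add: pux_order_ge_def zero_puiseux.rep_eq)

lemma pux_order_ge_sum: "(\<And>i. i \<in> A \<Longrightarrow> pux_order_ge r (f i)) \<Longrightarrow> pux_order_ge r (sum f A)"
  by (simp add: pux_order_ge_def pux_coeff_sum)

lemma pux_order_ge_add: "pux_order_ge r f \<Longrightarrow> pux_order_ge r g \<Longrightarrow> pux_order_ge r (f + g)"
  by (simp add: pux_order_ge_def plus_puiseux.rep_eq)

text \<open>
  An exponent \<open>u\<close> contributes to the coefficient of \<open>t\<^sup>w\<close> only if \<open>r \<le> u\<close> and \<open>s \<le> w - u\<close>. This is
  impossible for \<open>w < r + s\<close> and forces \<open>u = r\<close> for \<open>w = r + s\<close>. Here \<open>r\<close> and \<open>s\<close> are bounds that need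
  not be attained, so both sides of the coefficient equation may vanish.
\<close>

lemma pux_leading_mult:
  assumes f: "pux_order_ge r f" and g: "pux_order_ge s g"
  shows "pux_order_ge (r + s) (f * g)"
    and "pux_coeff (f * g) (r + s) = pux_coeff f r * pux_coeff g s"
proof -
  have lb: "r \<le> u \<and> s \<le> w - u" if "pux_coeff f u \<noteq> 0" "pux_coeff g (w - u) \<noteq> 0" for u w
    using f g that unfolding pux_order_ge_def by (meson not_le)
  have empty: "{u. pux_coeff f u \<noteq> 0 \<and> pux_coeff g (w - u) \<noteq> 0} = {}" if "w < r + s" for w
    using lb[of _ w] that by fastforce
  show "pux_order_ge (r + s) (f * g)"
    unfolding pux_order_ge_def times_puiseux.rep_eq
  proof (intro allI impI)
    fix w assume "w < r + s"
    show "(\<Sum>u | pux_coeff f u \<noteq> 0 \<and> pux_coeff g (w - u) \<noteq> 0. pux_coeff f u * pux_coeff g (w - u)) = 0"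
      unfolding empty[OF \<open>w < r + s\<close>] by simp
  qed
  have sub: "{u. pux_coeff f u \<noteq> 0 \<and> pux_coeff g (r + s - u) \<noteq> 0} \<subseteq> {r}"
    using lb[of _ "r + s"] by fastforce
  have "pux_coeff (f * g) (r + s) = (\<Sum>u\<in>{r}. pux_coeff f u * pux_coeff g (r + s - u))"
    unfolding times_puiseux.rep_eq by (rule sum.mono_neutral_left) (use sub in auto)
  then show "pux_coeff (f * g) (r + s) = pux_coeff f r * pux_coeff g s"
    by simp
qed

lemma pux_leading_prod:
  assumes "\<And>i. i \<in> A \<Longrightarrow> pux_order_ge (r i) (f i)"
  shows "pux_order_ge (sum r A) (prod f A) \<and>
    pux_coeff (prod f A) (sum r A) = (\<Prod>i\<in>A. pux_coeff (f i) (r i))"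
  using assms
proof (induction A rule: infinite_finite_induct)
  case (insert i A)
  then show ?case
    using pux_leading_mult[of "r i" "f i" "sum r A" "prod f A"] by simp
qed (simp_all add: pux_order_ge_def one_puiseux.rep_eq)

lemma pux_coeff_sign_mult: "pux_coeff (signof p * f) r = signof p * pux_coeff f r"
  by (rule sign_cases[of p]) (simp_all add: uminus_puiseux.rep_eq)

text \<open>
  If the lower bounds on the orders of the entries split into a row part and a column part, then
  every term of the Leibniz formula has the same bound, because a permutation meets each row and
  each column once. So the coefficients at that exponent are again given by a Leibniz formula.
\<close>

lemma pux_leading_det:
  assumes A: "A \<in> carrier_mat n n"
    and ord: "\<And>k l. k < n \<Longrightarrow> l < n \<Longrightarrow> pux_order_ge (r k + c l) (A $$ (k, l))"
  defines "R \<equiv> (\<Sum>k<n. r k) + (\<Sum>l<n. c l)"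
  shows "pux_order_ge R (det A)"
    and "pux_coeff (det A) R = det (mat n n (\<lambda>(k, l). pux_coeff (A $$ (k, l)) (r k + c l)))"
proof -
  have lead: "pux_order_ge R (\<Prod>k=0..<n. A $$ (k, p k)) \<and>
      pux_coeff (\<Prod>k=0..<n. A $$ (k, p k)) R = (\<Prod>k=0..<n. pux_coeff (A $$ (k, p k)) (r k + c (p k)))"
    if p: "p permutes {0..<n}" for p
  proof -
    have lt: "p k < n" if "k < n" for k
      using p that permutes_in_image[of p "{0..<n}" k] by auto
    have "(\<Sum>k=0..<n. c (p k)) = (\<Sum>l=0..<n. c l)"
      using sum.permute[OF p, of c] by (simp add: o_def)
    then have "(\<Sum>k=0..<n. r k + c (p k)) = R"
      by (simp add: sum.distrib R_def atLeast0LessThan)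
    then show ?thesis
      using pux_leading_prod[of "{0..<n}" "\<lambda>k. r k + c (p k)" "\<lambda>k. A $$ (k, p k)"] ord lt by simp
  qed
  show "pux_order_ge R (det A)"
    unfolding det_def'[OF A]
    by (rule pux_order_ge_sum) (use lead in \<open>auto simp: pux_order_ge_def pux_coeff_sign_mult\<close>)
  have "pux_coeff (det A) R = (\<Sum>p | p permutes {0..<n}. 
      signof p * (\<Prod>k=0..<n. pux_coeff (A $$ (k, p k)) (r k + c (p k))))"
    unfolding det_def'[OF A] pux_coeff_sum
    by (rule sum.cong) (use lead in \<open>auto simp: pux_coeff_sign_mult\<close>)
  also have "\<dots> = det (mat n n (\<lambda>(k, l). pux_coeff (A $$ (k, l)) (r k + c l)))"
  proof (subst det_def'[of _ n], simp, rule sum.cong[OF refl])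
    fix p :: "nat \<Rightarrow> nat" assume "p \<in> {p. p permutes {0..<n}}"
    then have "p k < n" if "k < n" for k
      using that permutes_in_image[of p "{0..<n}" k] by auto
    then show "signof p * (\<Prod>k=0..<n. pux_coeff (A $$ (k, p k)) (r k + c (p k))) =
        signof p * (\<Prod>k=0..<n. mat n n (\<lambda>(k, l). pux_coeff (A $$ (k, l)) (r k + c l)) $$ (k, p k))"
      by (intro arg_cong2[of _ _ _ _ "(*)"] prod.cong) auto
  qed
  finally show "pux_coeff (det A) R = det (mat n n (\<lambda>(k, l). pux_coeff (A $$ (k, l)) (r k + c l)))" .
qed

lemma pux_val_eqI:
  assumes "pux_order_ge r f" "pux_coeff f r \<noteq> 0"
  shows "pux_val f = ereal (of_rat r)"
proof -
  have "r \<le> s" if "pux_coeff f s \<noteq> 0" for s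
    using that assms(1) not_less[of s r] unfolding pux_order_ge_def by blast
  then have least: "(LEAST s. pux_coeff f s \<noteq> 0) = r"
    by (rule Least_equality[of "\<lambda>s. pux_coeff f s \<noteq> 0", OF assms(2)])
  have "f \<noteq> 0"
    using assms(2) by (metis zero_puiseux.rep_eq)
  then show ?thesis
    by (simp add: pux_val_def least)
qed

section \<open>Differences of adjacent columns\<close>

text \<open>
  By telescoping, the matrix is its matrix of column differences multiplied by the upper triangular
  matrix with all entries 1 on and above the diagonal.
\<close>

lemma det_adjacent_column_differences:
  fixes f :: "nat \<Rightarrow> nat \<Rightarrow> 'a :: comm_ring_1"
  shows "det (mat n n (\<lambda>(k, l). f k l)) =
    det (mat n n (\<lambda>(k, l). case l of 0 \<Rightarrow> f k 0 | Suc m \<Rightarrow> f k (Suc m) - f k m))"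
    (is "det ?M = det ?A")
proof -
  define B :: "'a mat" where "B = mat n n (\<lambda>(m, l). if m \<le> l then 1 else 0)"
  have "det B = prod_list (diag_mat B)"
    by (rule det_upper_triangular[of _ n]) (auto simp: B_def)
  also have "diag_mat B = map (\<lambda>_. 1) [0..<n]"
    by (auto simp: diag_mat_def B_def)
  finally have detB: "det B = 1"
    by (simp add: map_replicate_const)
  have "?M = ?A * B"
  proof (rule eq_matI)
    fix k l assume "k < dim_row (?A * B)" "l < dim_col (?A * B)"
    then have kl: "k < n" "l < n" by (simp_all add: B_def)
    have tele: "(\<Sum>m\<le>l. case m of 0 \<Rightarrow> f k 0 | Suc i \<Rightarrow> f k (Suc i) - f k i) = f k l"
      by (induction l) auto
    have "(?A * B) $$ (k, l) = (\<Sum>m<n. (case m of 0 \<Rightarrow> f k 0 | Suc i \<Rightarrow> f k (Suc i) - f k i) * 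
        (if m \<le> l then 1 else 0))"
      using kl by (auto simp: B_def scalar_prod_def atLeast0LessThan intro!: sum.cong)
    also have "\<dots> = (\<Sum>m\<le>l. case m of 0 \<Rightarrow> f k 0 | Suc i \<Rightarrow> f k (Suc i) - f k i)"
      by (rule sum.mono_neutral_cong_right) (use kl in auto)
    finally show "?M $$ (k, l) = (?A * B) $$ (k, l)"
      using kl tele by simp
  qed (simp_all add: B_def)
  then show ?thesis
    using det_mult[of ?A n B] detB by (simp add: B_def)
qed

section \<open>Determinants of path series\<close>

text \<open>
  What the determinant needs to know about the tree: \<open>path l\<close> is the set of edges from the root to
  leaf \<open>l\<close>, where the leaves are numbered \<open>0, \<dots>, n - 1\<close> from left to right, and \<open>h\<close> is the height of the
  top node of an edge. The fork \<open>m\<close> is the node where the paths to leaves \<open>m\<close> and \<open>m + 1\<close> separate; it has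
  height \<open>H m\<close> and depth \<open>rank m\<close>, and \<open>pivot m\<close> is the edge leading from it to the right. The edges
  that lie on only one of the two paths are below the fork, which gives \<open>h_le_H\<close> and, applied to the
  fork \<open>k\<close> and the edge \<open>pivot m\<close>, also \<open>pivot_triangular\<close>.
\<close>

locale path_system =
  fixes n :: nat and E :: "'e set" and path :: "nat \<Rightarrow> 'e set" and h :: "'e \<Rightarrow> rat" and d :: rat
    and H :: "nat \<Rightarrow> rat" and pivot :: "nat \<Rightarrow> 'e" and rank :: "nat \<Rightarrow> nat" and root :: nat
  assumes n_ge_3: "n \<ge> 3"
    and finite_E: "finite E"
    and path_subset: "l < n \<Longrightarrow> path l \<subseteq> E"
    and h_le_d: "e \<in> E \<Longrightarrow> h e \<le> d"
    and h_le_H: "Suc m < n \<Longrightarrow> (e \<in> path (Suc m)) \<noteq> (e \<in> path m) \<Longrightarrow> h e \<le> H m"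
    and pivot_right: "Suc m < n \<Longrightarrow> pivot m \<in> path (Suc m)"
    and pivot_left: "Suc m < n \<Longrightarrow> pivot m \<notin> path m"
    and h_pivot: "Suc m < n \<Longrightarrow> h (pivot m) = H m"
    and pivot_triangular: "Suc m < n \<Longrightarrow> Suc k < n \<Longrightarrow> k \<noteq> m \<Longrightarrow> rank m \<le> rank k \<Longrightarrow>
      pivot m \<in> path (Suc k) \<longleftrightarrow> pivot m \<in> path k"
    and root_fork: "Suc root < n"
    and rank_root: "Suc m < n \<Longrightarrow> rank root \<le> rank m"
    and H_root: "H root = d"
begin

text \<open>
  The coefficient of \<open>t\<close> to the power \<open>- w\<close> in the series of leaf \<open>l\<close> with edge coefficients \<open>b\<close>.
\<close>

definition level :: "nat \<Rightarrow> rat \<Rightarrow> ('e \<Rightarrow> complex) \<Rightarrow> complex" where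
  "level l w b = (\<Sum>e | e \<in> path l \<and> h e = w. b e)"

text \<open>
  The coefficients of the difference of the series of leaves \<open>m + 1\<close> and \<open>m\<close> at exponent \<open>- H m\<close>, and of
  their sum at exponent \<open>- d\<close>. They are the leading coefficients of the two factors of the difference
  of the squares.
\<close>

definition fork :: "nat \<Rightarrow> ('e \<Rightarrow> complex) \<Rightarrow> complex" where
  "fork m b = level (Suc m) (H m) b - level m (H m) b"

definition top_sum :: "nat \<Rightarrow> ('e \<Rightarrow> complex) \<Rightarrow> complex" where
  "top_sum m b = level (Suc m) d b + level m d b"

definition series :: "(nat \<times> 'e \<Rightarrow> complex) \<Rightarrow> nat \<Rightarrow> nat \<Rightarrow> puiseux" where
  "series a j l = (\<Sum>e\<in>path l. pux_monom (a (j, e)) (- h e))"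

definition series_matrix :: "(nat \<times> 'e \<Rightarrow> complex) \<Rightarrow> puiseux mat" where
  "series_matrix a = mat n n (\<lambda>(k, l).
     if k = 0 then 1 else if k = 1 then series a 1 l else if k = 2 then (series a 1 l)\<^sup>2
     else series a (k - 1) l)"

text \<open>
  Entry by entry the leading coefficients of the matrix of column differences; column \<open>m + 1\<close> belongs
  to the fork \<open>m\<close>.
\<close>

definition leading_matrix :: "(nat \<times> 'e \<Rightarrow> complex) \<Rightarrow> complex mat" where
  "leading_matrix a = mat n n (\<lambda>(k, l).
     let b = \<lambda>e. a (if k \<le> 2 then 1 else k - 1, e) in
     case l of
       0 \<Rightarrow> if k = 0 then 1 else if k = 2 then (level 0 d b)\<^sup>2 else level 0 d b
     | Suc m \<Rightarrow> if k = 0 then 0 else if k = 2 then fork m b * top_sum m b else fork m b)"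

definition total :: rat where
  "total = d + (\<Sum>m<n - 1. H m)"

lemma finite_path: "l < n \<Longrightarrow> finite (path l)"
  using path_subset finite_E finite_subset by blast

lemma sum_first_column: "(\<Sum>l<n. F l) = F 0 + (\<Sum>m<n - 1. F (Suc m))" for F :: "nat \<Rightarrow> 'b :: comm_monoid_add"
  using n_ge_3 sum.lessThan_Suc_shift[of F "n - 1"] by simp

lemma level_update:
  assumes "l < n"
  shows "level l w (b(e := y)) = level l w b + of_bool (e \<in> path l \<and> h e = w) * (y - b e)"
proof -
  let ?A = "{f. f \<in> path l \<and> h f = w}"
  have fin: "finite ?A"
    using finite_path[OF assms] by simp
  show ?thesis
  proof (cases "e \<in> ?A")
    case True
    have "sum (b(e := y)) (?A - {e}) = sum b (?A - {e})"
      by (rule sum.cong) auto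
    then show ?thesis
      using True sum.remove[OF fin True, of b] sum.remove[OF fin True, of "b(e := y)"]
      unfolding level_def by simp
  next
    case False
    then have "sum (b(e := y)) ?A = sum b ?A"
      by (intro sum.cong) auto
    then show ?thesis
      using False unfolding level_def by auto
  qed
qed

lemma level_cong: "l < n \<Longrightarrow> (\<And>e. e \<in> E \<Longrightarrow> b e = c e) \<Longrightarrow> level l w b = level l w c"
  unfolding level_def using path_subset by (intro sum.cong) auto

lemma pux_coeff_series:
  assumes "l < n"
  shows "pux_coeff (series a j l) (- w) = level l w (\<lambda>e. a (j, e))"
proof -
  have "pux_coeff (series a j l) (- w) = (\<Sum>e\<in>path l. if h e = w then a (j, e) else 0)"
    unfolding series_def pux_coeff_sum by (intro sum.cong) (auto simp: pux_monom.rep_eq)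
  also have "\<dots> = level l w (\<lambda>e. a (j, e))"
    unfolding level_def by (rule sum.mono_neutral_cong_right) (use finite_path[OF assms] in auto)
  finally show ?thesis .
qed

lemma series_order:
  assumes "l < n"
  shows "pux_order_ge (- d) (series a j l)"
  unfolding pux_order_ge_def
proof (intro allI impI)
  fix s assume "s < - d"
  then have empty: "{e. e \<in> path l \<and> h e = - s} = {}"
    using h_le_d path_subset[OF assms] by force
  have "level l (- s) (\<lambda>e. a (j, e)) = 0"
    unfolding level_def empty by simp
  then show "pux_coeff (series a j l) s = 0"
    using pux_coeff_series[OF assms, of a j "- s"] by simp
qed

text \<open>
  The edges of height above \<open>H m\<close> lie on both paths or on neither, so they cancel.
\<close>

lemma series_diff_order:
  assumes "Suc m < n"
  shows "pux_order_ge (- H m) (series a j (Suc m) - series a j m)"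
  unfolding pux_order_ge_def
proof (intro allI impI)
  fix s assume "s < - H m"
  then have "{e. e \<in> path (Suc m) \<and> h e = - s} = {e. e \<in> path m \<and> h e = - s}"
    using h_le_H[OF assms] by force
  then have "level (Suc m) (- s) b = level m (- s) b" for b
    by (simp add: level_def)
  then show "pux_coeff (series a j (Suc m) - series a j m) s = 0"
    using pux_coeff_series[of m a j "- s"] pux_coeff_series[of "Suc m" a j "- s"] assms
    by (simp add: minus_puiseux.rep_eq)
qed

lemma pux_coeff_series_diff:
  assumes "Suc m < n"
  shows "pux_coeff (series a j (Suc m) - series a j m) (- H m) = fork m (\<lambda>e. a (j, e))"
  using assms by (simp add: minus_puiseux.rep_eq pux_coeff_series fork_def)

lemma series_add_order:
  assumes "Suc m < n"
  shows "pux_order_ge (- d) (series a j (Suc m) + series a j m)"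
    and "pux_coeff (series a j (Suc m) + series a j m) (- d) = top_sum m (\<lambda>e. a (j, e))"
  using assms by (auto intro!: pux_order_ge_add series_order simp: plus_puiseux.rep_eq pux_coeff_series top_sum_def)

text \<open>
  The heights of the forks and the degrees of the rows give bounds on the orders of the column
  differences that split into a row part and a column part.
\<close>

lemma det_series_matrix_leading:
  shows "pux_order_ge (- total) (det (series_matrix a))"
    and "pux_coeff (det (series_matrix a)) (- total) = det (leading_matrix a)"
proof -
  define f where "f k l = (if k = 0 then 1 else if k = 1 then series a 1 l
      else if k = 2 then (series a 1 l)\<^sup>2 else series a (k - 1) l)" for k l :: nat
  define A where "A = mat n n (\<lambda>(k, l). case l of 0 \<Rightarrow> f k 0 | Suc m \<Rightarrow> f k (Suc m) - f k m)"
  \<comment> \<open>The first column has entries of orders at least \<open>0\<close>, \<open>- d\<close> and \<open>- 2 * d\<close>, but it matters only through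
    its entry 1, because the other entries of the first row vanish and satisfy any bound. So row \<open>0\<close> may
    take the part \<open>d\<close>, which compensates the part \<open>- d\<close> of column \<open>0\<close>.\<close>
  define r :: "nat \<Rightarrow> rat" where "r k = (if k = 0 then d else if k = 2 then - d else 0)" for k
  define c where "c l = (case l of 0 \<Rightarrow> - d | Suc m \<Rightarrow> - H m)" for l
  have det_A: "det (series_matrix a) = det A"
    using det_adjacent_column_differences[of n f] by (simp add: series_matrix_def A_def f_def)
  have entry: "pux_order_ge (r k + c l) (A $$ (k, l)) \<and> 
      pux_coeff (A $$ (k, l)) (r k + c l) = leading_matrix a $$ (k, l)"
    if kl: "k < n" "l < n" for k l
  proof (cases l)
    case 0
    have n: "0 < n" using kl by simp
    note s = series_order[OF n] pux_coeff_series[OF n]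
    have sq: "pux_order_ge (- d - d) ((series a 1 0)\<^sup>2)"
      "pux_coeff ((series a 1 0)\<^sup>2) (- d - d) = (level 0 d (\<lambda>e. a (1, e)))\<^sup>2"
      using pux_leading_mult[OF s(1) s(1), of a 1 a 1] s(2)[of a 1 d] by (simp_all add: power2_eq_square)
    show ?thesis
      using kl 0 sq s by (auto simp: A_def f_def r_def c_def leading_matrix_def Let_def 
          pux_order_ge_def one_puiseux.rep_eq)
  next
    case (Suc m)
    have m: "Suc m < n" using kl Suc by simp
    have sq: "(series a 1 (Suc m))\<^sup>2 - (series a 1 m)\<^sup>2 = 
        (series a 1 (Suc m) + series a 1 m) * (series a 1 (Suc m) - series a 1 m)"
      by (simp add: power2_eq_square algebra_simps)
    note prod = pux_leading_mult[OF series_add_order(1)[OF m] series_diff_order[OF m], of a 1 a 1, folded sq]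
    show ?thesis
      using kl Suc prod series_diff_order[OF m] pux_coeff_series_diff[OF m] series_add_order(2)[OF m]
      by (auto simp: A_def f_def r_def c_def leading_matrix_def Let_def pux_order_ge_0 zero_puiseux.rep_eq mult.commute)
  qed
  \<comment> \<open>The parts \<open>d\<close> of row 0 and \<open>- d\<close> of row 2 cancel, and \<open>- d\<close> from column 0 remains.\<close>
  have "(\<Sum>k<n. r k) = (\<Sum>k\<in>{0,2}. r k)"
    by (rule sum.mono_neutral_right) (use n_ge_3 in \<open>auto simp: r_def\<close>)
  then have "(\<Sum>k<n. r k) = 0"
    by (simp add: r_def)
  moreover have "(\<Sum>l<n. c l) = - total"
    by (simp add: sum_first_column c_def total_def sum_negf)
  ultimately have R: "(\<Sum>k<n. r k) + (\<Sum>l<n. c l) = - total"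
    by simp
  have carr: "A \<in> carrier_mat n n" by (simp add: A_def)
  have lead: "mat n n (\<lambda>(k, l). pux_coeff (A $$ (k, l)) (r k + c l)) = leading_matrix a"
    by (rule eq_matI) (use entry in \<open>auto simp: leading_matrix_def\<close>)
  show "pux_order_ge (- total) (det (series_matrix a))"
    using pux_leading_det(1)[of A n r c] carr entry unfolding R det_A by blast
  show "pux_coeff (det (series_matrix a)) (- total) = det (leading_matrix a)"
    using pux_leading_det(2)[of A n r c] carr entry unfolding R det_A lead by blast
qed

text \<open>
  The linear forms \<open>fork m\<close> form a triangular system: the coefficient at \<open>pivot m\<close> occurs in the form of
  the fork \<open>m\<close>, but in no other form of a fork that is at least as deep. So the prescribed values are
  reached by treating the deep forks first and correcting at one pivot at a time.
\<close>

lemma fork_values_arbitrary: "\<exists>b. \<forall>m. Suc m < n \<longrightarrow> fork m b = z m"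
proof -
  have "\<exists>b. \<forall>m\<in>V. fork m b = z m" if "finite V" "V \<subseteq> {m. Suc m < n}" for V
    using that
  \<comment> \<open>The negated rank makes the induction add the forks by decreasing depth.\<close>
  proof (induction V rule: finite_ranking_induct[where f = "\<lambda>m. - int (rank m)"])
    case (insert m V)
    then obtain b where b: "\<forall>k\<in>V. fork k b = z k" by auto
    define b' where "b' = b(pivot m := b (pivot m) + (z m - fork m b))"
    have m: "Suc m < n" using insert.prems by auto
    have "fork m b' = z m"
      using m pivot_right[OF m] pivot_left[OF m] h_pivot[OF m]
      by (simp add: fork_def b'_def level_update)
    moreover have "fork k b' = z k" if k: "k \<in> V" "k \<noteq> m" for k
    proof -
      have "Suc k < n" using insert.prems k by auto
      moreover have "rank m \<le> rank k" using insert.hyps(2)[OF k(1)] by simp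
      ultimately show ?thesis
        using pivot_triangular[OF m _ k(2)] b k(1) by (auto simp: fork_def b'_def level_update)
    qed
    ultimately have "\<forall>k\<in>insert m V. fork k b' = z k" by auto
    then show ?case by blast
  qed auto
  moreover have "finite {m. Suc m < n}"
    by (rule finite_subset[of _ "{..<n}"]) auto
  ultimately show ?thesis
    by (metis mem_Collect_eq order_refl)
qed

text \<open>
  Start from coefficients whose fork value is 1 at \<open>m\<close> and 0 elsewhere, and add \<open>s\<close> at the pivot of
  the root. This changes \<open>fork root\<close> by \<open>s\<close> and no other fork value. The pivot
  lies on one of the two paths at the root, but on both or none at the fork \<open>m\<close>, so \<open>top_sum root\<close>
  changes by \<open>s\<close> and \<open>top_sum m\<close> by \<open>2 * s\<close> or \<open>0\<close>. All but one value of \<open>s\<close> separate the two sums, so a nonzero one does.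
\<close>

lemma fork_top_sum_independent:
  assumes m: "Suc m < n" "m \<noteq> root"
  obtains b where "fork root b \<noteq> 0" "fork m b \<noteq> 0" "top_sum m b \<noteq> top_sum root b"
    "\<And>k. Suc k < n \<Longrightarrow> k \<noteq> root \<Longrightarrow> k \<noteq> m \<Longrightarrow> fork k b = 0"
proof -
  obtain b where b: "\<And>k. Suc k < n \<Longrightarrow> fork k b = of_bool (k = m)"
    using fork_values_arbitrary[of "\<lambda>k. of_bool (k = m)"] by blast
  define c where "c s = b(pivot root := b (pivot root) + s)" for s
  note pr = pivot_right[OF root_fork] pivot_left[OF root_fork] h_pivot[OF root_fork]
  have fork_root: "fork root (c s) = s" for s
    using b[OF root_fork] m pr root_fork by (simp add: fork_def c_def level_update)
  have fork_c: "fork k (c s) = of_bool (k = m)" if "Suc k < n" "k \<noteq> root" for k s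
    using b[of k] that pivot_triangular[OF root_fork _ _ rank_root]
    by (auto simp: fork_def c_def level_update)
  define \<delta> where "\<delta> = top_sum m b - top_sum root b"
  define \<epsilon> :: complex where "\<epsilon> = (if pivot root \<in> path m then 1 else - 1)"
  have diff: "top_sum m (c s) - top_sum root (c s) = \<delta> + \<epsilon> * s" for s
    using m pr root_fork H_root pivot_triangular[OF root_fork m(1) m(2) rank_root[OF m(1)]]
    by (simp add: top_sum_def c_def level_update \<delta>_def \<epsilon>_def)
  obtain s :: complex where s: "s \<noteq> 0" "\<delta> + \<epsilon> * s \<noteq> 0"
  proof (cases "\<delta> + \<epsilon> = 0")
    case True
    then have "\<delta> + \<epsilon> * 2 = \<epsilon>" by (simp add: algebra_simps)
    moreover have "\<epsilon> \<noteq> 0" by (simp add: \<epsilon>_def)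
    ultimately have "\<delta> + \<epsilon> * 2 \<noteq> 0" by metis
    then show ?thesis by (rule that[rotated]) simp
  next
    case False
    then show ?thesis using that[of 1] by simp
  qed
  show ?thesis
  proof (rule that)
    show "fork root (c s) \<noteq> 0" "fork m (c s) \<noteq> 0"
      using fork_root fork_c m s by simp_all
    show "top_sum m (c s) \<noteq> top_sum root (c s)"
      using diff[of s] s by auto
    show "fork k (c s) = 0" if "Suc k < n" "k \<noteq> root" "k \<noteq> m" for k
      using fork_c that by simp
  qed
qed

text \<open>
  Each row of index at least 3 is made the indicator of one of the forks other than the root and a
  second fork \<open>m\<close>. What remains is a two by two block with the rows \<open>fork\<close> and \<open>fork\<close> times \<open>top_sum\<close>,
  which is invertible if the fork values are nonzero and the two values of \<open>top_sum\<close> differ.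
\<close>

lemma leading_matrix_det_nonzero_ex:
  "\<exists>a \<in> {1..n - 2} \<times> E \<rightarrow>\<^sub>E UNIV. det (leading_matrix a) \<noteq> 0"
proof -
  obtain m where m: "Suc m < n" "m \<noteq> root"
    using n_ge_3 by (cases "root = 0") (auto intro: that[of 0] that[of 1])
  obtain b1 where b1: "fork root b1 \<noteq> 0" "fork m b1 \<noteq> 0" "top_sum m b1 \<noteq> top_sum root b1"
    "\<And>k. Suc k < n \<Longrightarrow> k \<noteq> root \<Longrightarrow> k \<noteq> m \<Longrightarrow> fork k b1 = 0"
    using fork_top_sum_independent[OF m] by blast
  have "card {3..<n} = card ({..<n - 1} - {root, m})"
    using root_fork m by (subst card_Diff_subset) auto
  then obtain g where g: "bij_betw g {3..<n} ({..<n - 1} - {root, m})"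
    using finite_same_card_bij[of "{3..<n}" "{..<n - 1} - {root, m}"] by auto
  have "\<exists>b. \<forall>l. Suc l < n \<longrightarrow> fork l b = of_bool (l = g k)" for k
    using fork_values_arbitrary[of "\<lambda>l. of_bool (l = g k)"] by blast
  then obtain b where b: "\<And>k l. Suc l < n \<Longrightarrow> fork l (b k) = of_bool (l = g k)"
    by metis
  \<comment> \<open>Row \<open>k \<ge> 3\<close> carries the coordinates with index \<open>j = k - 1\<close>.\<close>
  define a where "a = restrict (\<lambda>(j, e). if j = 1 then b1 e else b (Suc j) e) ({1..n - 2} \<times> E)"
  have a1: "level l w (\<lambda>e. a (1, e)) = level l w b1" if "l < n" for l w
    using n_ge_3 by (intro level_cong that) (auto simp: a_def)
  have a2: "level l w (\<lambda>e. a (k - 1, e)) = level l w (b k)" if "l < n" "3 \<le> k" "k < n" for l w k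
    using that by (intro level_cong that) (auto simp: a_def)
  have "det (leading_matrix a) \<noteq> 0"
  proof
    let ?N = "leading_matrix a"
    have N: "?N \<in> carrier_mat n n" by (simp add: leading_matrix_def)
    assume "det ?N = 0"
    then obtain w where w: "w \<in> carrier_vec n" "w \<noteq> 0\<^sub>v n" "?N *\<^sub>v w = 0\<^sub>v n"
      using det_0_iff_vec_prod_zero[OF N] by blast
    have row: "?N $$ (k, 0) * w $ 0 + (\<Sum>l<n - 1. ?N $$ (k, Suc l) * w $ Suc l) = 0" if "k < n" for k
    proof -
      have "(?N *\<^sub>v w) $ k = (\<Sum>l<n. ?N $$ (k, l) * w $ l)"
        using that w(1) N by (auto simp: scalar_prod_def atLeast0LessThan intro!: sum.cong)
      then show ?thesis
        using w(3) that by (simp add: sum_first_column)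
    qed
    have w0: "w $ 0 = 0"
      using row[of 0] n_ge_3 by (simp add: leading_matrix_def)
    have w_other: "w $ Suc l = 0" if l: "l < n - 1" "l \<noteq> root" "l \<noteq> m" for l
    proof -
      have "l \<in> g ` {3..<n}"
        using g l by (simp add: bij_betw_def)
      then obtain k where k: "3 \<le> k" "k < n" "l = g k" by auto
      have "?N $$ (k, Suc i) = of_bool (i = l)" if "i < n - 1" for i
        using that k b[of i k] a2 by (simp add: leading_matrix_def fork_def)
      then have "(\<Sum>i<n - 1. of_bool (i = l) * w $ Suc i) = 0"
        using row[OF k(2)] w0 by simp
      then show ?thesis
        using l by simp
    qed
    have split: "(\<Sum>l<n - 1. F l * w $ Suc l) = F root * w $ Suc root + F m * w $ Suc m" for F
    proof -
      have "(\<Sum>l<n - 1. F l * w $ Suc l) = (\<Sum>l\<in>{root, m}. F l * w $ Suc l)"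
        by (rule sum.mono_neutral_right) (use w_other root_fork m in auto)
      then show ?thesis using m by simp
    qed
    have forks: "fork l (\<lambda>e. a (1, e)) = fork l b1" "top_sum l (\<lambda>e. a (1, e)) = top_sum l b1"
      if "Suc l < n" for l
      using that a1 by (simp_all add: fork_def top_sum_def)
    have 1: "fork root b1 * w $ Suc root + fork m b1 * w $ Suc m = 0"
      using row[of 1] w0 n_ge_3 root_fork m forks unfolding split by (simp add: leading_matrix_def)
    have 2: "fork root b1 * top_sum root b1 * w $ Suc root + fork m b1 * top_sum m b1 * w $ Suc m = 0"
      using row[of 2] w0 n_ge_3 root_fork m forks unfolding split by (simp add: leading_matrix_def)
    have "(top_sum m b1 - top_sum root b1) * (fork m b1 * w $ Suc m) =
        (fork root b1 * top_sum root b1 * w $ Suc root + fork m b1 * top_sum m b1 * w $ Suc m) -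
        top_sum root b1 * (fork root b1 * w $ Suc root + fork m b1 * w $ Suc m)"
      by (simp add: algebra_simps)
    then have "(top_sum m b1 - top_sum root b1) * (fork m b1 * w $ Suc m) = 0"
      unfolding 1 2 by simp
    then have "w $ Suc m = 0" using b1 by simp
    moreover from this have "w $ Suc root = 0" using 1 b1 by simp
    ultimately have w_Suc: "w $ Suc l = 0" if "l < n - 1" for l
      using that w_other by blast
    have "w $ l = 0" if "l < n" for l
      using that w0 w_Suc by (cases l) auto
    then have "w = 0\<^sub>v n" using w by (intro eq_vecI) auto
    with w show False by blast
  qed
  moreover have "a \<in> {1..n - 2} \<times> E \<rightarrow>\<^sub>E UNIV" by (simp add: a_def)
  ultimately show ?thesis by blast
qed

lemma polyfun_det_leading_matrix: "polyfun ({1..n - 2} \<times> E) (\<lambda>a. det (leading_matrix a))"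
proof (rule polyfun_det)
  show "leading_matrix a \<in> carrier_mat n n" for a
    by (simp add: leading_matrix_def)
  fix k l assume kl: "k < n" "l < n"
  define j where "j = (if k \<le> 2 then 1 else k - 1)"
  have j: "j \<in> {1..n - 2}" using kl n_ge_3 by (auto simp: j_def)
  have lev: "polyfun ({1..n - 2} \<times> E) (\<lambda>a. level i w (\<lambda>e. a (j, e)))" if "i < n" for i w
    unfolding level_def
    by (rule polyfun_sum, rule polyfun_var) (use j path_subset[OF that] in auto)
  show "polyfun ({1..n - 2} \<times> E) (\<lambda>a. leading_matrix a $$ (k, l))"
  proof (cases l)
    case 0
    then have "leading_matrix a $$ (k, l) = (if k = 0 then 1
        else if k = 2 then (level 0 d (\<lambda>e. a (j, e)))\<^sup>2 else level 0 d (\<lambda>e. a (j, e)))" for a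
      using kl by (simp add: leading_matrix_def j_def Let_def)
    then show ?thesis
      using kl lev[of 0 d] by (cases "k = 0"; cases "k = 2") (simp_all add: polyfun_const polyfun_power)
  next
    case (Suc m)
    have "polyfun ({1..n - 2} \<times> E) (\<lambda>a. fork m (\<lambda>e. a (j, e)))"
      unfolding fork_def by (intro polyfun_diff lev) (use kl Suc in auto)
    moreover have "polyfun ({1..n - 2} \<times> E) (\<lambda>a. top_sum m (\<lambda>e. a (j, e)))"
      unfolding top_sum_def by (intro polyfun_add lev) (use kl Suc in auto)
    moreover have "leading_matrix a $$ (k, l) = (if k = 0 then 0
        else if k = 2 then fork m (\<lambda>e. a (j, e)) * top_sum m (\<lambda>e. a (j, e))
        else fork m (\<lambda>e. a (j, e)))" for a
      using kl Suc by (simp add: leading_matrix_def j_def Let_def)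
    ultimately show ?thesis
      by (cases "k = 0"; cases "k = 2") (simp_all add: polyfun_const polyfun_mult)
  qed
qed

lemma generic_valuation_series_matrix:
  "\<exists>U. zariski_open ({1..n - 2} \<times> E) U \<and> U \<noteq> {} \<and>
    (\<forall>a\<in>U. pux_val (det (series_matrix a)) = ereal (- of_rat total))"
proof (intro exI conjI ballI)
  let ?U = "{a \<in> {1..n - 2} \<times> E \<rightarrow>\<^sub>E UNIV. det (leading_matrix a) \<noteq> 0}"
  show "zariski_open ({1..n - 2} \<times> E) ?U"
    by (rule polyfun_nonzero_zariski_open[OF polyfun_det_leading_matrix])
  show "?U \<noteq> {}"
    using leading_matrix_det_nonzero_ex by blast
  fix a assume "a \<in> ?U"
  then show "pux_val (det (series_matrix a)) = ereal (- of_rat total)"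
    using pux_val_eqI[OF det_series_matrix_leading(1)] by (simp add: det_series_matrix_leading(2) of_rat_minus)
qed

end

section \<open>Heights in equidistant trees\<close>

text \<open>
  The distance from the node \<open>p\<close> to the leftmost leaf below it; in an equidistant tree, to every leaf
  below it.
\<close>

primrec node_height :: "wtree \<Rightarrow> bool list \<Rightarrow> real" where
  "node_height (Leaf i) p = 0"
| "node_height (Node u S v T) p =
    (case p of [] \<Rightarrow> u + node_height S [] | b # q \<Rightarrow> if b then node_height T q else node_height S q)"

primrec equidistant :: "wtree \<Rightarrow> bool" where
  "equidistant (Leaf i) = True"
| "equidistant (Node u S v T) \<longleftrightarrow>
    equidistant S \<and> equidistant T \<and> u + node_height S [] = v + node_height T []"

primrec leaf_list :: "wtree \<Rightarrow> (bool list \<times> nat) list" where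
  "leaf_list (Leaf i) = [([], i)]"
| "leaf_list (Node u S v T) =
    map (map_prod ((#) False) id) (leaf_list S) @ map (map_prod ((#) True) id) (leaf_list T)"

text \<open>
  The in-order traversal, which puts each internal node between the last leaf of its first subtree
  and the first leaf of its second subtree.
\<close>

primrec node_list :: "wtree \<Rightarrow> bool list list" where
  "node_list (Leaf i) = []"
| "node_list (Node u S v T) = map ((#) False) (node_list S) @ [[]] @ map ((#) True) (node_list T)"

lemma finite_edges: "finite (edges T)"
  by (induction T) auto

lemma Nil_not_edge: "[] \<notin> edges T"
  by (induction T) auto

lemma sum_edges_Node:
  fixes g :: "bool list \<Rightarrow> 'a :: comm_monoid_add"
  shows "sum g (edges (Node u S v T)) =
    g [False] + g [True] + (\<Sum>e\<in>edges S. g (False # e)) + (\<Sum>e\<in>edges T. g (True # e))"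
proof -
  have *: "sum g ((#) b ` A) = (\<Sum>e\<in>A. g (b # e))" for b A
    by (subst sum.reindex) (auto simp: inj_on_def)
  have "sum g (edges (Node u S v T)) = 
      sum g ({[False], [True]} \<union> (#) False ` edges S) + sum g ((#) True ` edges T)"
    unfolding edges.simps
    by (rule sum.union_disjoint) (auto simp: finite_edges Nil_not_edge)
  also have "sum g ({[False], [True]} \<union> (#) False ` edges S) = 
      sum g {[False], [True]} + sum g ((#) False ` edges S)"
    by (rule sum.union_disjoint) (auto simp: finite_edges Nil_not_edge)
  finally show ?thesis
    by (simp add: *)
qed

lemma weight_Cons:
  "e \<in> edges S \<Longrightarrow> weight (Node u S v T) (False # e) = weight S e"
  "e \<in> edges T \<Longrightarrow> weight (Node u S v T) (True # e) = weight T e"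
  by (cases e; simp add: Nil_not_edge)+

text \<open>
  Sums over paths are written as sums over all edges with a condition, since in this form they
  decompose along the recursion of the tree.
\<close>

lemma sum_weight_Node:
  "(\<Sum>f\<in>edges (Node u S v T). if P f then weight (Node u S v T) f else 0) =
    (if P [False] then u else 0) + (if P [True] then v else 0) +
    (\<Sum>e\<in>edges S. if P (False # e) then weight S e else 0) +
    (\<Sum>e\<in>edges T. if P (True # e) then weight T e else 0)"
proof -
  have "(\<Sum>e\<in>edges S. if P (False # e) then weight (Node u S v T) (False # e) else 0) =
      (\<Sum>e\<in>edges S. if P (False # e) then weight S e else 0)"
    and "(\<Sum>e\<in>edges T. if P (True # e) then weight (Node u S v T) (True # e) else 0) =
      (\<Sum>e\<in>edges T. if P (True # e) then weight T e else 0)"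
    by (rule sum.cong; simp add: weight_Cons)+
  then show ?thesis
    by (simp only: sum_edges_Node weight.simps)
qed

lemma ball_weight_Node:
  "(\<forall>e\<in>edges (Node u S v T). P (weight (Node u S v T) e)) \<longleftrightarrow>
    P u \<and> P v \<and> (\<forall>e\<in>edges S. P (weight S e)) \<and> (\<forall>e\<in>edges T. P (weight T e))"
  by (auto simp: ball_Un weight_Cons)

lemma Cons_in_leaves_Node: "(b # p, i) \<in> leaves (Node u S v T) \<longleftrightarrow> (p, i) \<in> leaves (if b then T else S)"
  by (cases b) (force simp: image_iff)+

lemma leaves_nonempty: "leaves T \<noteq> {}"
  by (induction T) auto

lemma edge_above_leaf: "e \<in> edges T \<Longrightarrow> \<exists>p i. (p, i) \<in> leaves T \<and> prefix e p"
proof (induction T arbitrary: e)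
  case (Node u S v T)
  obtain p i q j where "(p, i) \<in> leaves S" "(q, j) \<in> leaves T"
    using leaves_nonempty[of S] leaves_nonempty[of T] by auto
  then have leaf: "\<exists>p i. (p, i) \<in> leaves (if b then T else S)" for b by auto
  from Node.prems obtain b e' where e: "e = b # e'"
    using Nil_not_edge by (cases e) auto
  with Node.prems have "e' = [] \<or> e' \<in> edges (if b then T else S)"
    by (cases b) auto
  then have "\<exists>p i. (p, i) \<in> leaves (if b then T else S) \<and> prefix e' p"
    using leaf[of b] Node.IH by (cases b) auto
  then show ?case
    unfolding e by (metis Cons_in_leaves_Node Cons_prefix_Cons)
qed simp

lemma prefix_of_leaf_edge: "(p, i) \<in> leaves T \<Longrightarrow> prefix e p \<Longrightarrow> e \<noteq> [] \<Longrightarrow> e \<in> edges T"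
proof (induction T arbitrary: e p)
  case (Node u S v T)
  then obtain b e' where e: "e = b # e'" by (cases e) auto
  with Node.prems obtain p' where p: "p = b # p'" "prefix e' p'" by (cases p) auto
  from Node.prems p have "(p', i) \<in> leaves (if b then T else S)" by auto
  then have "e' = [] \<or> e' \<in> edges (if b then T else S)"
    using Node.IH p by (cases b) auto
  then show ?case using e by (cases b) auto
qed simp

lemma path_weight:
  assumes "equidistant T" "(p, i) \<in> leaves T"
  shows "(\<Sum>f\<in>edges T. if prefix f p then weight T f else 0) = node_height T []"
  using assms
proof (induction T arbitrary: p)
  case (Node u S v T)
  show ?case
  proof (cases p)
    case (Cons b q)
    then have "(q, i) \<in> leaves (if b then T else S)"
      using Node.prems by auto
    then show ?thesis
      using Node.IH[of q] Node.prems Cons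
      by (cases b) (auto simp: sum_weight_Node simp del: edges.simps)
  qed (use Node.prems in auto)
qed simp

text \<open>
  All subtrees of a tree with equal leaf depths have equal leaf depths, with the weight of the edge
  above the subtree subtracted. The distance is not assumed to be positive, as it is 0 at a leaf.
\<close>

lemma equidistantI:
  assumes "\<And>p i. (p, i) \<in> leaves T \<Longrightarrow> (\<Sum>f\<in>edges T. if prefix f p then weight T f else 0) = d"
  shows "equidistant T \<and> node_height T [] = d"
  using assms
proof (induction T arbitrary: d)
  case (Leaf i)
  then show ?case by simp
next
  case (Node u S v T)
  have "(\<Sum>f\<in>edges S. if prefix f p then weight S f else 0) = d - u" if "(p, i) \<in> leaves S" for p i
    using Node.prems[of "False # p" i] that
    by (simp add: sum_weight_Node Cons_in_leaves_Node del: edges.simps leaves.simps)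
  moreover have "(\<Sum>f\<in>edges T. if prefix f p then weight T f else 0) = d - v" if "(p, i) \<in> leaves T" for p i
    using Node.prems[of "True # p" i] that
    by (simp add: sum_weight_Node Cons_in_leaves_Node del: edges.simps leaves.simps)
  ultimately show ?case
    using Node.IH(1)[of "d - u"] Node.IH(2)[of "d - v"] by simp
qed

lemma path_weight_below_edge:
  assumes "equidistant T" "(p, i) \<in> leaves T" "prefix e p" "e \<noteq> []"
  shows "(\<Sum>f\<in>edges T. if prefix f p \<and> prefix e f then weight T f else 0) = node_height T (butlast e)"
  using assms
proof (induction T arbitrary: p e)
  case (Node u S v T)
  from Node.prems obtain b e' where e: "e = b # e'" by (cases e) auto
  with Node.prems obtain q where q: "p = b # q" "prefix e' q" by (cases p) auto
  have leaf: "(q, i) \<in> leaves (if b then T else S)"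
    using Node.prems q by auto
  show ?case
  proof (cases "e' = []")
    case True
    then show ?thesis
      using path_weight[of S q i] path_weight[of T q i] leaf Node.prems q e
      by (cases b) (auto simp: sum_weight_Node simp del: edges.simps)
  next
    case False
    then show ?thesis
      using Node.IH[of q e'] leaf Node.prems q e
      by (cases b) (auto simp: sum_weight_Node simp del: edges.simps)
  qed
qed simp

lemma node_height_antimono:
  assumes "equidistant T" "\<forall>e\<in>edges T. weight T e \<ge> 0" "prefix p q"
  shows "node_height T q \<le> node_height T p"
  using assms
proof (induction T arbitrary: p q)
  case (Node u S v T)
  then have nonneg: "u \<ge> 0" "v \<ge> 0" "\<forall>e\<in>edges S. weight S e \<ge> 0" "\<forall>e\<in>edges T. weight T e \<ge> 0"
    unfolding ball_weight_Node by blast+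
  show ?case
  proof (cases q)
    case Nil
    then show ?thesis using Node.prems by simp
  next
    case (Cons b r)
    have IH: "node_height (if b then T else S) r \<le> node_height (if b then T else S) s" if "prefix s r" for s
      using Node.IH Node.prems nonneg that by (cases b) auto
    from Cons Node.prems IH[of "[]"] IH[of "tl p"] nonneg show ?thesis
      by (cases p; cases b) auto
  qed
qed simp

lemma node_height_Rats: "\<forall>e\<in>edges T. weight T e \<in> \<rat> \<Longrightarrow> node_height T p \<in> \<rat>"
proof (induction T arbitrary: p)
  case (Node u S v T)
  then have "u \<in> \<rat>" "\<forall>e\<in>edges S. weight S e \<in> \<rat>" "\<forall>e\<in>edges T. weight T e \<in> \<rat>"
    using ball_weight_Node[of u S v T "\<lambda>x. x \<in> \<rat>"] by blast+
  with Node.IH show ?case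
    by (auto split: list.splits)
qed simp

section \<open>Leaves and forks from left to right\<close>

lemma set_leaf_list: "set (leaf_list T) = leaves T"
  by (induction T) auto

lemma distinct_leaf_list: "distinct (leaf_list T)"
  by (induction T) (auto simp: distinct_map inj_on_def)

lemma distinct_node_list: "distinct (node_list T)"
  by (induction T) (auto simp: distinct_map inj_on_def)

lemma length_leaf_list: "length (leaf_list T) = Suc (length (node_list T))"
  by (induction T) auto

lemma Nil_in_node_list: "node_list T \<noteq> [] \<Longrightarrow> [] \<in> set (node_list T)"
  by (cases T) auto

lemma node_between_leaves:
  assumes "m < length (node_list T)"
  shows "prefix (node_list T ! m @ [False]) (fst (leaf_list T ! m))"
    and "prefix (node_list T ! m @ [True]) (fst (leaf_list T ! Suc m))"
proof -
  have "prefix (node_list T ! m @ [False]) (fst (leaf_list T ! m)) \<and>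
      prefix (node_list T ! m @ [True]) (fst (leaf_list T ! Suc m))"
    using assms
  proof (induction T arbitrary: m)
    case (Node u S v T)
    let ?s = "length (node_list S)"
    consider "m < ?s" | "m = ?s" | k where "m = Suc (?s + k)" "k < length (node_list T)"
      using Node.prems less_imp_Suc_add[of ?s m] by (cases m ?s rule: linorder_cases) auto
    then show ?case
      by cases (use Node.IH in \<open>auto simp: nth_append length_leaf_list nth_Cons'\<close>)
  qed simp
  then show "prefix (node_list T ! m @ [False]) (fst (leaf_list T ! m))"
    "prefix (node_list T ! m @ [True]) (fst (leaf_list T ! Suc m))" by auto
qed

text \<open>
  In an equidistant tree the weight of an edge is the height of its top node minus the height of its
  bottom node. An internal node is the top of two edges and, except for the root, the bottom of one,
  so its height counts once, and the height of the root twice.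
\<close>

lemma total_weight_node_heights:
  assumes "equidistant T"
  shows "total_weight T = node_height T [] + sum_list (map (node_height T) (node_list T))"
  using assms
proof (induction T)
  case (Node u S v T)
  have "total_weight (Node u S v T) = u + v + total_weight S + total_weight T"
    using sum_weight_Node[of "\<lambda>_. True" u S v T] unfolding total_weight_def by simp
  with Node show ?case
    by (simp add: o_def)
qed (simp add: total_weight_def)

text \<open>
  An edge above \<open>v\<close> belongs to both paths, so an edge that belongs to only one of them is below \<open>v\<close>.
\<close>

lemma edge_separating_branches:
  assumes "prefix (v @ [False]) p" "prefix (v @ [True]) q" "prefix e p \<noteq> prefix e q"
  shows "strict_prefix v e"
proof -
  have v: "prefix v p" "prefix v q"
    using assms append_prefixD by blast+
  then have "\<not> prefix e v"
    using assms(3) prefix_order.trans by blast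
  moreover have "prefix e v \<or> prefix v e"
    using assms(3) v prefix_same_cases by blast
  ultimately show ?thesis
    unfolding strict_prefix_def by auto
qed

lemma strict_prefix_butlast: "strict_prefix v e \<Longrightarrow> prefix v (butlast e)"
  by (auto simp: strict_prefix_def prefix_def butlast_append)

section \<open>The determinant of a tree\<close>

lemma root_path_leaf:
  assumes "inj_on snd (leaves T)" "(p, i) \<in> leaves T"
  shows "root_path T i = {e \<in> edges T. prefix e p}"
proof -
  have "q = p" if "(q, i) \<in> leaves T" for q
    using inj_onD[OF assms(1) _ that assms(2)] by simp
  then show ?thesis
    using assms(2) unfolding root_path_def by blast
qed

lemma root_path_leaf_list:
  assumes "inj_on snd (leaves T)" "l < length (leaf_list T)"
  shows "root_path T (snd (leaf_list T ! l)) = {e \<in> edges T. prefix e (fst (leaf_list T ! l))}"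
  using assms set_leaf_list[of T] nth_mem[of l "leaf_list T"] by (intro root_path_leaf) simp_all

text \<open>
  The defining property of \<open>height\<close> determines a value only because there is a leaf below the edge.
\<close>

lemma height_node_height:
  assumes "inj_on snd (leaves T)" "equidistant T" "e \<in> edges T"
  shows "height T e = node_height T (butlast e)"
proof -
  have sum: "(\<Sum>f | f \<in> root_path T i \<and> prefix e f. weight T f) = node_height T (butlast e)"
    if "e \<in> root_path T i" for i
  proof -
    from that obtain p where p: "(p, i) \<in> leaves T" "prefix e p"
      unfolding root_path_def by blast
    have "{f. f \<in> root_path T i \<and> prefix e f} = {f \<in> edges T. prefix f p \<and> prefix e f}"
      unfolding root_path_leaf[OF assms(1) p(1)] by auto
    then have "(\<Sum>f | f \<in> root_path T i \<and> prefix e f. weight T f) = 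
        (\<Sum>f\<in>edges T. if prefix f p \<and> prefix e f then weight T f else 0)"
      by (simp add: sum.inter_filter[OF finite_edges])
    also have "\<dots> = node_height T (butlast e)"
      using assms p Nil_not_edge by (intro path_weight_below_edge) auto
    finally show ?thesis .
  qed
  obtain i where "e \<in> root_path T i"
    using edge_above_leaf[OF assms(3)] assms(3) unfolding root_path_def by blast
  then show ?thesis
    unfolding height_def by (intro the_equality) (use sum in auto)
qed

lemma det_permute_columns:
  assumes A: "A \<in> carrier_mat n n" and p: "p permutes {0..<n}"
  shows "det (mat n n (\<lambda>(k, l). A $$ (k, p l))) = signof p * det A"
proof -
  let ?B = "mat n n (\<lambda>(k, l). A $$ (k, p l))"
  have "p l < n" if "l < n" for l
    using that permutes_in_image[OF p, of l] by auto
  then have "transpose_mat ?B = mat n n (\<lambda>(k, l). transpose_mat A $$ (p k, l))"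
    using A by (intro eq_matI) auto
  then show ?thesis
    using det_permute_rows[of "transpose_mat A" n p] det_transpose[of ?B n] det_transpose[OF A] A p by simp
qed

lemma pux_val_signof_mult: "pux_val (signof p * f) = pux_val f"
proof -
  have "pux_val (- f) = pux_val f"
    by (simp add: pux_val_def uminus_puiseux.rep_eq)
  then show ?thesis
    by (cases p rule: sign_cases) simp_all
qed

lemma of_rat_the_inv: "x \<in> \<rat> \<Longrightarrow> of_rat (the_inv of_rat x :: rat) = (x :: real)"
  by (rule f_the_inv_into_f) (auto simp: Rats_def inj_on_def)

lemma ultrametric_tree_equidistant:
  assumes "ultrametric_tree n d T"
  shows "equidistant T \<and> node_height T [] = d"
proof (rule equidistantI)
  have bij: "bij_betw snd (leaves T) {1..n}"
    using assms by (simp add: ultrametric_tree_def)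
  then have inj: "inj_on snd (leaves T)"
    by (rule bij_betw_imp_inj_on)
  fix p i assume leaf: "(p, i) \<in> leaves T"
  then have "i \<in> {1..n}"
    using bij bij_betw_imp_surj_on by force
  then have "(\<Sum>e\<in>root_path T i. weight T e) = d"
    using assms by (simp add: ultrametric_tree_def)
  then show "(\<Sum>f\<in>edges T. if prefix f p then weight T f else 0) = d"
    by (simp add: root_path_leaf[OF inj leaf] sum.inter_filter[OF finite_edges])
qed

text \<open>
  The fork \<open>m\<close> is the internal node at position \<open>m\<close> of the in-order traversal, and its pivot is the edge
  to its second subtree.
\<close>

lemma tree_path_system:
  assumes "n \<ge> 3" and ultra: "ultrametric_tree n d T" and rat: "\<forall>e\<in>edges T. weight T e \<in> \<rat>"
  defines "R \<equiv> (the_inv of_rat :: real \<Rightarrow> rat)"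
  assumes root: "r < length (node_list T)" "node_list T ! r = []"
  shows "path_system n (edges T) (\<lambda>l. root_path T (snd (leaf_list T ! l))) (\<lambda>e. R (height T e)) (R d)
    (\<lambda>m. R (node_height T (node_list T ! m))) (\<lambda>m. node_list T ! m @ [True])
    (\<lambda>m. length (node_list T ! m)) r"
proof -
  have bij: "bij_betw snd (leaves T) {1..n}" and nonneg: "\<forall>e\<in>edges T. weight T e \<ge> 0"
    using ultra by (simp_all add: ultrametric_tree_def)
  then have inj: "inj_on snd (leaves T)"
    by (simp add: bij_betw_imp_inj_on)
  have eq: "equidistant T" and d: "node_height T [] = d"
    using ultrametric_tree_equidistant[OF ultra] by auto
  have len: "length (leaf_list T) = n"
    using bij_betw_same_card[OF bij] distinct_card[OF distinct_leaf_list[of T]] set_leaf_list[of T] by simp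
  have lenN: "Suc m < n \<longleftrightarrow> m < length (node_list T)" for m
    using len length_leaf_list[of T] by auto
  have R_mono: "R (node_height T q) \<le> R (node_height T p)" if "prefix p q" for p q
  proof -
    have "(of_rat (R (node_height T q)) :: real) \<le> of_rat (R (node_height T p))"
      using node_height_antimono[OF eq nonneg that] node_height_Rats[OF rat]
      by (simp add: R_def of_rat_the_inv)
    then show ?thesis by (simp add: of_rat_less_eq)
  qed
  have height: "height T e = node_height T (butlast e)" if "e \<in> edges T" for e
    by (rule height_node_height[OF inj eq that])
  define p where "p l = fst (leaf_list T ! l)" for l
  have path: "root_path T (snd (leaf_list T ! l)) = {e \<in> edges T. prefix e (p l)}" if "l < n" for l
    using root_path_leaf_list[OF inj] len that by (simp add: p_def)
  note fork = node_between_leaves[of _ T, folded p_def]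
  have separate: "strict_prefix (node_list T ! m) e" 
    if "Suc m < n" "(e \<in> root_path T (snd (leaf_list T ! Suc m))) \<noteq> (e \<in> root_path T (snd (leaf_list T ! m)))"
    for m e
    using edge_separating_branches[OF fork[of m], of e] that path[of m] path[of "Suc m"] lenN[of m] by auto
  have pivot: "node_list T ! m @ [True] \<in> edges T" if "Suc m < n" for m
  proof (rule prefix_of_leaf_edge)
    show "(p (Suc m), snd (leaf_list T ! Suc m)) \<in> leaves T"
      using that len set_leaf_list[of T] nth_mem[of "Suc m" "leaf_list T"] by (simp add: p_def)
    show "prefix (node_list T ! m @ [True]) (p (Suc m))"
      using fork(2) that lenN by blast
  qed simp
  show ?thesis
  proof
    show "n \<ge> 3" "finite (edges T)" by (fact, rule finite_edges)
    show "root_path T (snd (leaf_list T ! l)) \<subseteq> edges T" if "l < n" for l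
      by (auto simp: root_path_def)
    show "R (height T e) \<le> R d" if "e \<in> edges T" for e
      using R_mono[of "[]"] d height[OF that] by simp
    show "R (height T e) \<le> R (node_height T (node_list T ! m))"
      if "Suc m < n" "(e \<in> root_path T (snd (leaf_list T ! Suc m))) \<noteq> (e \<in> root_path T (snd (leaf_list T ! m)))"
      for m e
    proof -
      have "e \<in> edges T"
        using that(2) by (auto simp: root_path_def)
      then show ?thesis
        using R_mono[OF strict_prefix_butlast[OF separate[OF that]]] height by simp
    qed
    show "node_list T ! m @ [True] \<in> root_path T (snd (leaf_list T ! Suc m))" if "Suc m < n" for m
      using path[OF that] pivot[OF that] fork(2) that lenN by simp
    show "node_list T ! m @ [True] \<notin> root_path T (snd (leaf_list T ! m))" if "Suc m < n" for m
    proof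
      assume "node_list T ! m @ [True] \<in> root_path T (snd (leaf_list T ! m))"
      then have "prefix (node_list T ! m @ [True]) (p m)"
        using path[of m] that by simp
      moreover have "prefix (node_list T ! m @ [False]) (p m)"
        using fork(1) that lenN by blast
      ultimately show False
        by (auto simp: prefix_def)
    qed
    show "R (height T (node_list T ! m @ [True])) = R (node_height T (node_list T ! m))" if "Suc m < n" for m
      using height[OF pivot[OF that]] by simp
    show "(node_list T ! m @ [True] \<in> root_path T (snd (leaf_list T ! Suc k))) \<longleftrightarrow>
        (node_list T ! m @ [True] \<in> root_path T (snd (leaf_list T ! k)))"
      if "Suc m < n" "Suc k < n" "k \<noteq> m" "length (node_list T ! m) \<le> length (node_list T ! k)" for m k
    proof (rule ccontr)
      \<comment> \<open>If \<open>pivot m\<close> separates the two paths at the fork \<open>k\<close>, it is below the node \<open>k\<close>. Then \<open>k\<close> is an ancestor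
        of the node \<open>m\<close> or equal to it, and the latter follows from the depths.\<close>
      assume "\<not> ?thesis"
      then have "strict_prefix (node_list T ! k) (node_list T ! m @ [True])"
        using separate[of k "node_list T ! m @ [True]"] that by blast
      then have "prefix (node_list T ! k) (node_list T ! m)"
        using strict_prefix_butlast by fastforce
      then have "node_list T ! k = node_list T ! m"
        using that(4) by (auto simp: prefix_def)
      then show False
        using that distinct_node_list[of T] lenN by (simp add: nth_eq_iff_index_eq)
    qed
    show "Suc r < n" using root lenN by simp
    show "length (node_list T ! r) \<le> length (node_list T ! m)" if "Suc m < n" for m
      using root by simp
    show "R (node_height T (node_list T ! r)) = R d"
      using root d by simp
  qed
qed

theorem proposition3p1:
  fixes n :: nat and d :: real and T :: wtree
  assumes "n \<ge> 4" and "ultrametric_tree n d T" and "\<forall>e\<in>edges T. weight T e \<in> \<rat>"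
  shows "\<exists>U. zariski_open ({1..n-2} \<times> edges T) U \<and> U \<noteq> {} \<and>
    (\<forall>a\<in>U. pux_val (det (tree_matrix n T a)) = ereal (- total_weight T))"
proof -
  have bij: "bij_betw snd (leaves T) {1..n}"
    using assms by (simp add: ultrametric_tree_def)
  have eq: "equidistant T" and d: "node_height T [] = d"
    using ultrametric_tree_equidistant[OF assms(2)] by auto
  have len: "length (leaf_list T) = n"
    using bij_betw_same_card[OF bij] distinct_card[OF distinct_leaf_list[of T]] set_leaf_list[of T] by simp
  then have lenN: "length (node_list T) = n - 1"
    using length_leaf_list[of T] by simp
  then obtain r where r: "r < length (node_list T)" "node_list T ! r = []"
    using Nil_in_node_list[of T] assms(1) by (fastforce simp: in_set_conv_nth)
  let ?R = "the_inv of_rat :: real \<Rightarrow> rat"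
  interpret path_system n "edges T" "\<lambda>l. root_path T (snd (leaf_list T ! l))" "\<lambda>e. ?R (height T e)" "?R d"
    "\<lambda>m. ?R (node_height T (node_list T ! m))" "\<lambda>m. node_list T ! m @ [True]"
    "\<lambda>m. length (node_list T ! m)" r
    by (rule tree_path_system) (use assms r in auto)
  have "d \<in> \<rat>"
    using node_height_Rats[OF assms(3), of "[]"] d by simp
  then have "(of_rat total :: real) = d + (\<Sum>m<n - 1. node_height T (node_list T ! m))"
    using node_height_Rats[OF assms(3)]
    by (simp add: total_def of_rat_add of_rat_sum of_rat_the_inv)
  also have "\<dots> = total_weight T"
    by (simp add: total_weight_node_heights[OF eq] d sum_list_sum_nth lenN atLeast0LessThan)
  finally have total: "of_rat total = total_weight T" .
  \<comment> \<open>The columns are indexed by the labels, which need not increase from left to right.\<close>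
  define \<sigma> where "\<sigma> l = (if l < n then snd (leaf_list T ! l) - 1 else l)" for l
  have "bij_betw (\<lambda>l. leaf_list T ! l) {..<n} (leaves T)"
    using bij_betw_nth[OF distinct_leaf_list refl refl, of T] by (simp add: len set_leaf_list)
  then have label: "bij_betw (\<lambda>l. snd (leaf_list T ! l)) {..<n} {1..n}"
    using bij_betw_trans[OF _ bij] by (simp add: o_def)
  moreover have "bij_betw (\<lambda>i. i - 1) {1..n} {..<n}"
    by (rule bij_betw_byWitness[where f' = Suc]) auto
  ultimately have "bij_betw ((\<lambda>i. i - 1) \<circ> (\<lambda>l. snd (leaf_list T ! l))) {..<n} {..<n}"
    by (rule bij_betw_trans)
  then have "bij_betw \<sigma> {0..<n} {0..<n}"
    unfolding atLeast0LessThan by (rule bij_betw_cong[THEN iffD1, rotated]) (simp add: \<sigma>_def)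
  then have \<sigma>: "\<sigma> permutes {0..<n}"
    by (rule bij_imp_permutes) (simp add: \<sigma>_def)
  have \<sigma>_label: "\<sigma> l < n" "Suc (\<sigma> l) = snd (leaf_list T ! l)" if "l < n" for l
  proof -
    have "snd (leaf_list T ! l) \<in> {1..n}"
      using label that bij_betwE by blast
    then show "\<sigma> l < n" "Suc (\<sigma> l) = snd (leaf_list T ! l)"
      using that by (auto simp: \<sigma>_def)
  qed
  have "series_matrix a = mat n n (\<lambda>(k, l). tree_matrix n T a $$ (k, \<sigma> l))" for a
    using \<sigma>_label by (intro eq_matI)
      (auto simp: series_matrix_def tree_matrix_def series_def leaf_series_def Let_def)
  then have "pux_val (det (series_matrix a)) = pux_val (det (tree_matrix n T a))" for a
    using det_permute_columns[of "tree_matrix n T a" n \<sigma>] \<sigma> pux_val_signof_mult[of \<sigma>] 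
    by (simp add: tree_matrix_def)
  then show ?thesis
    using generic_valuation_series_matrix by (simp add: total)
qed

end
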